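(* Let $p>3$ be a prime and let $x$ be a $p$-adic integer. If $x\not\equiv-1/2\pmod p$, then $$\sum_{k=0}^{p-1}s_k(x)^2\equiv(-1)^{\langle x\rangle_p}\frac{p+2(x-\langle x\rangle_p)}{2x+1}\pmod{p^2}.$$ Also, $$\sum_{k=0}^{p-1}s_k(x)^2\equiv \frac{(-1)^{x}p}{2x+1}\pmod{p^3}\quad\text{for } x=0,1,\ldots,p-1.$$ Moreover (for every $p$-adic integer $x$), $$\sum_{k=0}^{p-1}(2k+1)s_k(x)^2\equiv0\pmod{p^2}.$$
   Context: For $n\in\{0,1,2,\ldots\}$, $s_n(x)=\sum_{k=0}^n\binom nk\binom xk\binom{x+k}k$, where $\binom xk=x(x-1)\cdots(x-k+1)/k!$. For a $p$-adic integer $x$, $\langle x\rangle_p$ denotes the least nonnegative integer $r$ with $x\equiv r\pmod p$. For $p$-adic numbers $a,b$, $a\equiv b\pmod{p^m}$ means $(a-b)/p^m$ is a $p$-adic integer. *)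

theory Defs
  imports
    "Berlekamp_Zassenhaus.Finite_Field"
    "HOL-Computational_Algebra.Polynomial_Factorial"
begin

text \<open>
  The prime \<open>p\<close> is the cardinality of a type \<open>'p\<close> of class \<open>prime_card\<close>.
  The \<open>p\<close>-adic integers are the inverse limit of the rings \<open>\<int>/p\<^sup>n\<int>\<close>: coherent sequences of
  residues, each represented in \<open>{0..<p\<^sup>n}\<close>.
\<close>

typedef (overloaded) 'p :: prime_card padic_int =
  "{f :: nat \<Rightarrow> int. \<forall>n. f n \<in> {0..<int CARD('p) ^ n} \<and> f (Suc n) mod int CARD('p) ^ n = f n}"
  by (rule exI[of _ "\<lambda>_. 0"]) (auto simp: prime_card prime_gt_0_nat)

setup_lifting type_definition_padic_int

lemma card_pos_int [simp]: "0 < int CARD('p :: prime_card)"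
  using prime_gt_0_nat[OF prime_card[where 'a='p]] by simp

lemma padic_int_coherentI:
  fixes h :: "nat \<Rightarrow> int"
  assumes "h (Suc n) mod int CARD('p :: prime_card) ^ n = h n mod int CARD('p) ^ n"
  shows "h n mod int CARD('p) ^ n \<in> {0..<int CARD('p) ^ n} \<and>
         h (Suc n) mod int CARD('p) ^ Suc n mod int CARD('p) ^ n = h n mod int CARD('p) ^ n"
  using assms by (simp add: mod_mod_cancel)

instantiation padic_int :: (prime_card) comm_ring_1
begin

lift_definition zero_padic_int :: "'a padic_int" is "\<lambda>_. 0"
  by simp

lift_definition one_padic_int :: "'a padic_int" is "\<lambda>n. 1 mod int CARD('a) ^ n"
  by (auto simp: mod_mod_cancel)

lift_definition plus_padic_int :: "'a padic_int \<Rightarrow> 'a padic_int \<Rightarrow> 'a padic_int"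
  is "\<lambda>f g n. (f n + g n) mod int CARD('a) ^ n"
  by (rule padic_int_coherentI) (metis mod_add_cong mod_mod_trivial)

lift_definition minus_padic_int :: "'a padic_int \<Rightarrow> 'a padic_int \<Rightarrow> 'a padic_int"
  is "\<lambda>f g n. (f n - g n) mod int CARD('a) ^ n"
  by (rule padic_int_coherentI) (metis mod_diff_cong mod_mod_trivial)

lift_definition uminus_padic_int :: "'a padic_int \<Rightarrow> 'a padic_int"
  is "\<lambda>f n. (- f n) mod int CARD('a) ^ n"
  by (rule padic_int_coherentI) (metis mod_minus_cong mod_mod_trivial)

lift_definition times_padic_int :: "'a padic_int \<Rightarrow> 'a padic_int \<Rightarrow> 'a padic_int"
  is "\<lambda>f g n. (f n * g n) mod int CARD('a) ^ n"
  by (rule padic_int_coherentI) (metis mod_mult_cong mod_mod_trivial)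

instance
proof
  fix a b c :: "'a padic_int"
  show "a * b * c = a * (b * c)"
    by transfer (simp add: mod_simps mult.assoc)
  show "a * b = b * a"
    by transfer (simp add: mult.commute)
  show "1 * a = a"
    by transfer (auto simp: mod_simps fun_eq_iff)
  show "a + b + c = a + (b + c)"
    by transfer (simp add: mod_simps add.assoc)
  show "a + b = b + a"
    by transfer (simp add: add.commute)
  show "0 + a = a"
    by transfer (auto simp: fun_eq_iff)
  show "- a + a = 0"
    by transfer (simp add: mod_simps)
  show "a - b = a + - b"
    by transfer (simp add: mod_simps)
  show "(a + b) * c = a * c + b * c"
    by transfer (simp add: mod_simps distrib_right)
  show "(0 :: 'a padic_int) \<noteq> 1"
  proof
    assume "(0 :: 'a padic_int) = 1"
    then have "1 mod int CARD('a) ^ 1 = 0"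
      by transfer (metis)
    then show False
      using prime_gt_1_nat[OF prime_card[where 'a='a]] by simp
  qed
qed

end

lemma padic_int_residue_mod:
  fixes x :: "'p :: prime_card padic_int"
  assumes "m \<le> n"
  shows "Rep_padic_int x n mod int CARD('p) ^ m = Rep_padic_int x m"
  using assms
proof (induction n rule: dec_induct)
  case base
  then show ?case using Rep_padic_int[of x] by simp
next
  case (step n)
  have "Rep_padic_int x (Suc n) mod int CARD('p) ^ m
      = Rep_padic_int x (Suc n) mod int CARD('p) ^ n mod int CARD('p) ^ m"
    using step.hyps by (simp add: mod_mod_cancel le_imp_power_dvd)
  then show ?case using Rep_padic_int[of x] step.IH by simp
qed

instance padic_int :: (prime_card) idom
proof
  fix x y :: "'a padic_int"
  let ?p = "int CARD('a)"
  have p: "prime ?p" by (rule prime_card_int)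
  assume "x \<noteq> 0" "y \<noteq> 0"
  then obtain m n where mn: "Rep_padic_int x m \<noteq> 0" "Rep_padic_int y n \<noteq> 0"
    by (metis (no_types, opaque_lifting) Rep_padic_int_inject zero_padic_int.rep_eq ext)
  define a b where "a = Rep_padic_int x (m + n)" and "b = Rep_padic_int y (m + n)"
  have ndvd: "\<not> ?p ^ m dvd a" "\<not> ?p ^ n dvd b"
    using mn padic_int_residue_mod[of m "m + n" x] padic_int_residue_mod[of n "m + n" y]
    by (auto simp: a_def b_def dvd_eq_mod_eq_0)
  then have ab: "a \<noteq> 0" "b \<noteq> 0" by auto
  have "multiplicity ?p a < m" "multiplicity ?p b < n"
    using ndvd by (meson multiplicity_dvd' not_le)+
  moreover have "multiplicity ?p (a * b) = multiplicity ?p a + multiplicity ?p b"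
    using ab p by (simp add: prime_elem_multiplicity_mult_distrib)
  ultimately have "\<not> ?p ^ (m + n) dvd a * b"
    using multiplicity_geI[of "a * b" ?p "m + n"] ab p not_prime_unit by fastforce
  then have "Rep_padic_int (x * y) (m + n) \<noteq> 0"
    by (simp add: times_padic_int.rep_eq a_def b_def dvd_eq_mod_eq_0)
  then show "x * y \<noteq> 0"
    by (auto simp: zero_padic_int.rep_eq)
qed

lemma padic_int_of_nat_residue:
  "Rep_padic_int (of_nat k :: 'p :: prime_card padic_int) n = int k mod int CARD('p) ^ n"
  by (induction k)
     (simp_all add: zero_padic_int.rep_eq one_padic_int.rep_eq plus_padic_int.rep_eq mod_simps)

instance padic_int :: (prime_card) ring_char_0
proof
  show "inj (of_nat :: nat \<Rightarrow> 'a padic_int)"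
  proof (rule injI)
    fix j k :: nat
    assume eq: "(of_nat j :: 'a padic_int) = of_nat k"
    let ?n = "j + k"
    have "j + k < CARD('a) ^ ?n"
      using power_gt_expt[of "CARD('a)" ?n] prime_gt_1_nat[OF prime_card[where 'a='a]] by simp
    then have "int j < int CARD('a) ^ ?n" "int k < int CARD('a) ^ ?n"
      by (metis add_lessD1 of_nat_less_iff of_nat_power, metis add.commute add_lessD1 of_nat_less_iff of_nat_power)
    moreover have "int j mod int CARD('a) ^ ?n = int k mod int CARD('a) ^ ?n"
      using eq by (metis padic_int_of_nat_residue)
    ultimately show "j = k" by simp
  qed
qed

instance fract :: ("{idom, ring_char_0}") field_char_0
  by standard (auto intro!: injI simp: of_nat_fract eq_fract)

type_synonym 'p padic = "'p padic_int fract"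

definition padic_Ints :: "'p :: prime_card padic set" (\<open>\<int>\<^sub>p\<close>)
  where "\<int>\<^sub>p = range to_fract"

definition padic_cong :: "'p :: prime_card padic \<Rightarrow> 'p padic \<Rightarrow> nat \<Rightarrow> bool"
    (\<open>(\<open>indent=1\<close>[_ \<equiv> _] '(mod _'))\<close>)
  where "[a \<equiv> b] (mod m) \<longleftrightarrow> (a - b) / of_nat m \<in> \<int>\<^sub>p"

definition least_residue :: "'p :: prime_card padic \<Rightarrow> nat" (\<open>\<langle>_\<rangle>\<^sub>p\<close>)
  where "\<langle>x\<rangle>\<^sub>p = (LEAST r. [x \<equiv> of_nat r] (mod CARD('p)))"

definition s_poly :: "nat \<Rightarrow> 'a :: field_char_0 \<Rightarrow> 'a"
  where "s_poly n x = (\<Sum>k=0..n. of_nat (n choose k) * (x gchoose k) * ((x + of_nat k) gchoose k))"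

end

theory Submission
  imports Defs
begin

text \<open>
  Write \<open>s\<^sub>n(x) = (\<Sum>k. (n choose k) a\<^sub>k(x))\<close>. In \<open>n\<close> these functions satisfy the self-adjoint recurrence
  \<open>(n+1)\<^sup>2 (s\<^sub>n\<^sub>+\<^sub>1 - s\<^sub>n) - n\<^sup>2 (s\<^sub>n - s\<^sub>n\<^sub>-\<^sub>1) = x(x+1) s\<^sub>n\<close>. Summation by parts then expresses
  \<open>\<Sum>(2k+1) s\<^sub>k(x)\<^sup>2\<close> as a multiple of \<open>p\<^sup>2\<close>, and it yields the Christoffel-Darboux formula for
  \<open>(x(x+1) - y(y+1)) \<Sum>s\<^sub>k(x) s\<^sub>k(y)\<close>. For \<open>x \<noteq> -1/2\<close> modulo \<open>p\<close>, take \<open>y = x + p\<^sup>2\<close>: the factors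
  \<open>p\<^sup>2\<close> cancel, and modulo \<open>p\<^sup>2\<close> only the increment of \<open>(x choose p) (x+p choose p)\<close> survives.

  For natural \<open>x = j\<close>, \<open>s\<^sub>n(j)\<close> is a polynomial in \<open>n\<close> of parity \<open>j\<close> under \<open>n \<mapsto> -1-n\<close>, and it also satisfies
  a three-term recurrence in \<open>j\<close>. For \<open>i\<close>, \<open>j\<close> of equal parity, \<open>\<Sum>n<N. s\<^sub>n(i) s\<^sub>n(j)\<close> is an odd polynomial in \<open>N\<close>.
  Its linear coefficient vanishes for \<open>i \<noteq> j\<close> by Christoffel-Darboux and equals \<open>(-1)\<^sup>j / (2j+1)\<close> for
  \<open>i = j\<close> by the recurrence in \<open>j\<close>. Putting \<open>N = p\<close> settles \<open>i + j < p\<close>; the boundary case \<open>i + j = p - 1\<close>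
  needs \<open>(\<Sum>i\<le>(p-1)/2. 1/i\<^sup>2) \<equiv> 0\<close> modulo \<open>p\<close>. For larger \<open>j\<close> the recurrence in \<open>j\<close> is
  used again, now modulo \<open>p\<^sup>3\<close>.
\<close>

section \<open>Recurrences\<close>

text \<open>The summand (x choose k) (x+k choose k) as a product: consecutive quotients are
  explicit, and for \<open>k < p\<close> every denominator is visibly prime to
  \<open>p\<close>.\<close>

definition sfac :: "nat \<Rightarrow> 'a :: field_char_0 \<Rightarrow> 'a"
  where "sfac k x = (\<Prod>i<k. (x - of_nat i) * (x + of_nat i + 1) / (of_nat i + 1)\<^sup>2)"

lemma sfac_0 [simp]: "sfac 0 x = 1"
  by (simp add: sfac_def)

lemma sfac_Suc:
  "(of_nat k + 1)\<^sup>2 * sfac (Suc k) x = sfac k x * ((x - of_nat k) * (x + of_nat k + 1))"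
proof -
  have "(of_nat k + 1 :: 'a)\<^sup>2 \<noteq> 0"
    by (metis add.commute of_nat_Suc of_nat_neq_0 power_not_zero)
  then show ?thesis by (simp add: sfac_def)
qed

text \<open>Up to factorials, \<open>sfac k x\<close> is the product of the consecutive numbers from
  \<open>x - k + 1\<close> to \<open>x + k\<close>. Raising both \<open>k\<close> and
  \<open>x\<close> by one keeps the lower end and appends two factors at the top.\<close>

lemma sfac_Suc_shift:
  "(of_nat k + 1)\<^sup>2 * sfac (Suc k) (x + 1) = sfac k x * ((x + of_nat k + 1) * (x + of_nat k + 2))"
proof (induction k)
  case 0
  then show ?case by (simp add: sfac_def algebra_simps)
next
  case (Suc k)
  have nz: "(of_nat k + 1 :: 'a)\<^sup>2 \<noteq> 0"
    by (metis add.commute of_nat_Suc of_nat_neq_0 power_not_zero)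
  let ?k = "of_nat k :: 'a"
  have step: "(?k + 2)\<^sup>2 * sfac (Suc (Suc k)) (x + 1) = sfac (Suc k) (x + 1) * ((x - ?k) * (x + ?k + 3))"
    using sfac_Suc[of "Suc k" "x + 1"] by (simp add: algebra_simps)
  have "(?k + 1)\<^sup>2 * ((?k + 2)\<^sup>2 * sfac (Suc (Suc k)) (x + 1))
      = ((?k + 1)\<^sup>2 * sfac (Suc k) (x + 1)) * ((x - ?k) * (x + ?k + 3))"
    unfolding step by (simp only: mult_ac)
  also have "\<dots> = (sfac k x * ((x - ?k) * (x + ?k + 1))) * ((x + ?k + 2) * (x + ?k + 3))"
    by (simp add: Suc.IH)
  also have "\<dots> = (?k + 1)\<^sup>2 * (sfac (Suc k) x * ((x + ?k + 2) * (x + ?k + 3)))"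
    by (simp flip: sfac_Suc)
  finally have "(?k + 2)\<^sup>2 * sfac (Suc (Suc k)) (x + 1) = sfac (Suc k) x * ((x + ?k + 2) * (x + ?k + 3))"
    using nz by simp
  then show ?case by (simp add: algebra_simps)
qed

lemma sfac_eq_gbinomial: "(x gchoose k) * ((x + of_nat k) gchoose k) = sfac k x"
proof -
  have "fact k * fact k = (\<Prod>i<k. (of_nat i + 1 :: 'a)\<^sup>2)"
    by (simp add: fact_prod_Suc power2_eq_square lessThan_atLeast0 add.commute flip: prod.distrib)
  moreover have "x gchoose k = (\<Prod>i<k. x - of_nat i) / fact k"
    by (simp add: gbinomial_prod_rev lessThan_atLeast0)
  moreover have "(x + of_nat k) gchoose k = (\<Prod>i<k. x + of_nat i + 1) / fact k"
    by (simp add: gbinomial_pochhammer' pochhammer_prod lessThan_atLeast0 add_ac)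
  ultimately show ?thesis
    by (simp add: sfac_def prod_dividef prod.distrib)
qed

text \<open>Binomials vanish above \<open>n\<close>, so any \<open>M\<close> from \<open>n\<close>
  on serves as upper limit; sums for different \<open>n\<close> can share one range.\<close>

lemma s_poly_eq_sum:
  assumes "n \<le> M"
  shows "s_poly n x = (\<Sum>k\<le>M. of_nat (n choose k) * sfac k x)"
proof -
  have "s_poly n x = (\<Sum>k\<le>n. of_nat (n choose k) * sfac k x)"
    by (simp add: s_poly_def sfac_eq_gbinomial mult.assoc atMost_atLeast0)
  also have "\<dots> = (\<Sum>k\<le>M. of_nat (n choose k) * sfac k x)"
    by (rule sum.mono_neutral_left) (use assms in \<open>auto simp: binomial_eq_0\<close>)
  finally show ?thesis .
qed

lemma s_poly_0 [simp]: "s_poly 0 x = 1"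
  by (simp add: s_poly_def)

text \<open>Pascal's rule leaves one shifted binomial in each term.\<close>

lemma s_poly_Suc_diff:
  assumes "n \<le> M"
  shows "s_poly (Suc n) x - s_poly n x = (\<Sum>k\<le>M. of_nat (n choose k) * sfac (Suc k) x)"
  using assms
  by (simp only: s_poly_eq_sum[of "Suc n" "Suc M"] s_poly_eq_sum[of n "Suc M"] le_SucI Suc_le_mono
        sum.atMost_Suc_shift)
     (simp add: sum.distrib algebra_simps flip: sum_subtractf)

text \<open>Subtraction is taken in the ring, so the identity also covers \<open>k > n\<close>,
  where both sides are 0.\<close>

lemma binomial_absorb_of_nat:
  "(of_nat k + 1) * of_nat (n choose Suc k) = (of_nat n - of_nat k) * (of_nat (n choose k) :: 'a :: comm_ring_1)"
proof (cases "k \<le> n")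
  case True
  have "Suc k * (n choose Suc k) = (n - k) * (n choose k)"
    by (metis binomial_absorb_comp binomial_absorption mult.commute)
  then have "(of_nat (Suc k * (n choose Suc k)) :: 'a) = of_nat ((n - k) * (n choose k))"
    by (simp only:)
  then show ?thesis using True by (simp only: of_nat_mult of_nat_Suc of_nat_diff add.commute)
qed (simp add: binomial_eq_0)

lemma binomial_absorb_Suc_of_nat:
  "(of_nat n + 1) * of_nat (n choose k) = (of_nat n + 1 - of_nat k) * (of_nat (Suc n choose k) :: 'a :: comm_ring_1)"
proof (cases k)
  case 0
  then show ?thesis by simp
next
  case (Suc l)
  show ?thesis
    using binomial_absorb_of_nat[of l n, where 'a='a] by (simp add: Suc algebra_simps)
qed

text \<open>Pascal's rule produces terms \<open>sfac (Suc k) x\<close>, and \<open>sfac_Suc\<close>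
  leads back to \<open>sfac k x\<close> with the factor \<open>x * (x + 1) - k * (k + 1)\<close>; a
  shifted sum cancels its \<open>k\<close>-part.\<close>

lemma s_poly_recurrence_index:
  "(of_nat n + 2)\<^sup>2 * (s_poly (Suc (Suc n)) x - s_poly (Suc n) x)
     - (of_nat n + 1)\<^sup>2 * (s_poly (Suc n) x - s_poly n x) = x * (x + 1) * s_poly (Suc n) x"
proof -
  define m where "m = (of_nat (Suc n) :: 'a)"
  define B where "B k = (of_nat (Suc n choose k) :: 'a)" for k
  let ?M = "Suc n"
  have B: "(of_nat k + 1) * B (Suc k) = (m - of_nat k) * B k" for k
    unfolding m_def B_def by (rule binomial_absorb_of_nat)
  have C: "m * of_nat (n choose k) = (m - of_nat k) * B k" for k
    using binomial_absorb_Suc_of_nat[of n k, where 'a='a] by (simp add: m_def B_def add.commute)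
  have "(of_nat n + 2)\<^sup>2 * (s_poly (Suc (Suc n)) x - s_poly (Suc n) x)
     - (of_nat n + 1)\<^sup>2 * (s_poly (Suc n) x - s_poly n x)
     = (\<Sum>k\<le>?M. ((m + 1)\<^sup>2 * B k - m * (m * of_nat (n choose k))) * sfac (Suc k) x)"
    unfolding s_poly_Suc_diff[of "Suc n" ?M, OF order_refl] s_poly_Suc_diff[of n ?M, OF le_SucI[OF order_refl]]
      sum_distrib_left sum_subtractf [symmetric]
    by (intro sum.cong refl) (simp add: m_def B_def algebra_simps power2_eq_square)
  also have "\<dots> = (\<Sum>k\<le>?M. (m * of_nat k + 2 * m + 1) * B k * sfac (Suc k) x)"
    unfolding C by (intro sum.cong refl) (simp add: algebra_simps power2_eq_square)
  \<comment> \<open>\<open>m * k + 2 * m + 1 = (k + 1)^2 + (k + 2) * (m - k)\<close>: the first part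
    suits \<open>sfac_Suc\<close>, the second raises the index of \<open>B\<close>, so that its sum
    can be shifted.\<close>
  also have "\<dots> = (\<Sum>k\<le>?M. (of_nat k + 1)\<^sup>2 * B k * sfac (Suc k) x)
                + (\<Sum>k\<le>?M. (of_nat k + 1) * (of_nat k + 2) * B (Suc k) * sfac (Suc k) x)"
    unfolding sum.distrib [symmetric]
  proof (intro sum.cong refl)
    fix k
    have B': "(of_nat k + 1) * (of_nat k + 2) * B (Suc k) = (of_nat k + 2) * ((m - of_nat k) * B k)"
      by (simp flip: B)
    show "(m * of_nat k + 2 * m + 1) * B k * sfac (Suc k) x
       = (of_nat k + 1)\<^sup>2 * B k * sfac (Suc k) x
         + (of_nat k + 1) * (of_nat k + 2) * B (Suc k) * sfac (Suc k) x"
      unfolding B' by (simp add: algebra_simps power2_eq_square)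
  qed
  also have "(\<Sum>k\<le>?M. (of_nat k + 1) * (of_nat k + 2) * B (Suc k) * sfac (Suc k) x)
      = (\<Sum>k\<le>Suc ?M. of_nat k * (of_nat k + 1) * B k * sfac k x)"
    by (simp only: sum.atMost_Suc_shift[of _ ?M]) (simp add: algebra_simps)
  also have "\<dots> = (\<Sum>k\<le>?M. of_nat k * (of_nat k + 1) * B k * sfac k x)"
    by (simp add: B_def binomial_eq_0)
  also have "(\<Sum>k\<le>?M. (of_nat k + 1)\<^sup>2 * B k * sfac (Suc k) x)
      = (\<Sum>k\<le>?M. B k * (sfac k x * ((x - of_nat k) * (x + of_nat k + 1))))"
    unfolding sfac_Suc [symmetric] by (simp only: mult_ac)
  also have "\<dots> + (\<Sum>k\<le>?M. of_nat k * (of_nat k + 1) * B k * sfac k x)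
      = x * (x + 1) * s_poly (Suc n) x"
    unfolding s_poly_eq_sum[OF order_refl] sum.distrib [symmetric] sum_distrib_left B_def
    by (intro sum.cong refl) (simp add: algebra_simps)
  finally show ?thesis .
qed

text \<open>\<open>coeff\<close> proves the relation for single coefficients at the cost of a term
  of lower index. Absorption moves that term to \<open>B k\<close>, and
  \<open>2 * (n - k) + (2 * k + 1) = 2 * n + 1\<close>.\<close>

lemma s_poly_recurrence_argument:
  "(x + 1)\<^sup>2 * s_poly n (x + 1) - x\<^sup>2 * s_poly n (x - 1) = (2 * x + 1) * (2 * of_nat n + 1) * s_poly n x"
proof -
  define B where "B k = (of_nat (n choose k) :: 'a)" for k
  have B: "(of_nat k + 1) * B (Suc k) = (of_nat n - of_nat k) * B k" for k
    unfolding B_def by (rule binomial_absorb_of_nat)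
  have coeff: "(x + 1)\<^sup>2 * sfac (Suc k) (x + 1) - x\<^sup>2 * sfac (Suc k) (x - 1)
      = (2 * x + 1) * (2 * (of_nat k + 1) * sfac k x + (2 * of_nat k + 3) * sfac (Suc k) x)" for k
  proof -
    let ?k = "of_nat k + 1 :: 'a"
    have nz: "?k\<^sup>2 \<noteq> 0"
      by (metis add.commute of_nat_Suc of_nat_neq_0 power_not_zero)
    \<comment> \<open>\<open>sfac\<close> is invariant under \<open>x\<close> to
      \<open>-1 - x\<close>, which exchanges its linear factors up to sign; the step down to
      \<open>x - 1\<close> becomes a step up from \<open>-1 - x\<close>.\<close>
    have refl: "sfac (Suc k) (x - 1) = sfac (Suc k) (- x)" "sfac k x = sfac k (- 1 - x)"
      unfolding sfac_def by (intro prod.cong refl; simp add: algebra_simps)+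
    have 1: "?k\<^sup>2 * sfac (Suc k) (x + 1) = sfac k x * ((x + ?k) * (x + ?k + 1))"
      using sfac_Suc_shift[of k x] by (simp add: algebra_simps)
    have 2: "?k\<^sup>2 * sfac (Suc k) (x - 1) = sfac k x * ((x - ?k) * (x - ?k + 1))"
      using sfac_Suc_shift[of k "- 1 - x"] by (simp add: refl algebra_simps)
    have "?k\<^sup>2 * ((x + 1)\<^sup>2 * sfac (Suc k) (x + 1) - x\<^sup>2 * sfac (Suc k) (x - 1))
       = (x + 1)\<^sup>2 * (?k\<^sup>2 * sfac (Suc k) (x + 1)) - x\<^sup>2 * (?k\<^sup>2 * sfac (Suc k) (x - 1))"
      by (simp add: algebra_simps)
    also have "\<dots> = (2 * x + 1) * (2 * ?k * ?k\<^sup>2 * sfac k x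
                      + (2 * of_nat k + 3) * (sfac k x * ((x - of_nat k) * (x + of_nat k + 1))))"
      unfolding 1 2 by (simp add: algebra_simps power2_eq_square)
    also have "\<dots> = ?k\<^sup>2 * ((2 * x + 1) * (2 * ?k * sfac k x + (2 * of_nat k + 3) * sfac (Suc k) x))"
      unfolding sfac_Suc [symmetric] by (simp add: algebra_simps)
    finally show ?thesis using nz by simp
  qed
  have "(x + 1)\<^sup>2 * s_poly n (x + 1) - x\<^sup>2 * s_poly n (x - 1)
     = (\<Sum>k\<le>Suc n. B k * ((x + 1)\<^sup>2 * sfac k (x + 1) - x\<^sup>2 * sfac k (x - 1)))"
    by (simp only: s_poly_eq_sum[of n "Suc n"] sum_distrib_left flip: sum_subtractf)
       (simp add: B_def algebra_simps)
  also have "\<dots> = (2 * x + 1) * (1 + (\<Sum>k\<le>n. 2 * ((of_nat k + 1) * B (Suc k)) * sfac k x)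
                + (\<Sum>k\<le>n. (2 * of_nat k + 3) * B (Suc k) * sfac (Suc k) x))"
    by (simp only: sum.atMost_Suc_shift coeff)
       (simp add: B_def sum_distrib_left sum.distrib algebra_simps power2_eq_square)
  also have "1 + (\<Sum>k\<le>n. 2 * ((of_nat k + 1) * B (Suc k)) * sfac k x)
                + (\<Sum>k\<le>n. (2 * of_nat k + 3) * B (Suc k) * sfac (Suc k) x)
     = (\<Sum>k\<le>n. 2 * ((of_nat n - of_nat k) * B k) * sfac k x)
                + (\<Sum>k\<le>Suc n. (2 * of_nat k + 1) * B k * sfac k x)"
    by (simp only: sum.atMost_Suc_shift B) (simp add: B_def algebra_simps binomial_eq_0)
  also have "\<dots> = (2 * of_nat n + 1) * s_poly n x"
    by (simp add: s_poly_eq_sum[of n n] sum_distrib_left B_def binomial_eq_0 algebra_simps flip: sum.distrib)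
  finally show ?thesis by (simp add: mult.assoc)
qed

section \<open>Summation formulas obtained from the recurrence in the index\<close>

lemma s_poly_difference_eq_sum:
  "of_nat (Suc n)^2 * (s_poly (Suc n) x - s_poly n x) = x * (x + 1) * (\<Sum>k\<le>n. s_poly k x)"
proof (induction n)
  case 0
  then show ?case by (simp add: s_poly_def)
next
  case (Suc n)
  then show ?case
    using s_poly_recurrence_index[of n x] by (simp add: algebra_simps)
qed

text \<open>The recurrence for \<open>x\<close> times the value at \<open>y\<close>, minus the same
  with the roles exchanged, telescopes.\<close>

lemma s_poly_Christoffel_Darboux:
  "(x * (x + 1) - y * (y + 1)) * (\<Sum>k\<le>n. s_poly k x * s_poly k y)
     = of_nat (Suc n)^2 * (s_poly (Suc n) x * s_poly n y - s_poly n x * s_poly (Suc n) y)"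
proof (induction n)
  case 0
  then show ?case by (simp add: s_poly_def)
next
  case (Suc n)
  have "of_nat (Suc (Suc n))^2 * (s_poly (Suc (Suc n)) x * s_poly (Suc n) y - s_poly (Suc n) x * s_poly (Suc (Suc n)) y)
    = of_nat (Suc (Suc n))^2 * (s_poly (Suc (Suc n)) x - s_poly (Suc n) x) * s_poly (Suc n) y
     - of_nat (Suc (Suc n))^2 * (s_poly (Suc (Suc n)) y - s_poly (Suc n) y) * s_poly (Suc n) x"
    by (simp add: algebra_simps)
  also have "\<dots> = of_nat (Suc n)^2 * (s_poly (Suc n) x - s_poly n x) * s_poly (Suc n) y
        - of_nat (Suc n)^2 * (s_poly (Suc n) y - s_poly n y) * s_poly (Suc n) x
        + (x * (x + 1) - y * (y + 1)) * (s_poly (Suc n) x * s_poly (Suc n) y)"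
    unfolding s_poly_difference_eq_sum by (simp add: algebra_simps)
  also have "\<dots> = of_nat (Suc n)^2 * (s_poly (Suc n) x * s_poly n y - s_poly n x * s_poly (Suc n) y)
        + (x * (x + 1) - y * (y + 1)) * (s_poly (Suc n) x * s_poly (Suc n) y)"
    by (simp add: algebra_simps)
  finally show ?case
    unfolding sum.atMost_Suc distrib_left[of _ "sum _ _"] Suc.IH by (rule sym)
qed

text \<open>Summation by parts with \<open>2 * k + 1 = (k + 1)^2 - k^2\<close>. The difference of
  \<open>s_poly\<close> is kept on the right so that both terms show the factor
  \<open>(n + 1)^2\<close>, which is \<open>p^2\<close> for \<open>n = p - 1\<close>.\<close>

lemma sum_odd_weighted_s_poly_square:
  "(\<Sum>k\<le>n. of_nat (2 * k + 1) * (s_poly k x)\<^sup>2)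
    = of_nat (Suc n)^2 * (s_poly n x)\<^sup>2
      + of_nat (Suc n)^2 * (s_poly (Suc n) x - s_poly n x) * (s_poly n x - (\<Sum>k\<le>n. s_poly k x))"
proof (induction n)
  case 0
  then show ?case by simp
next
  case (Suc n)
  define E where "E = (\<Sum>k\<le>n. s_poly k x)"
  define L where "L = x * (x + 1)"
  define m where "m = (of_nat (Suc n) :: 'a)"
  have 1: "m^2 * (s_poly (Suc n) x - s_poly n x) = L * E"
    unfolding E_def L_def m_def by (rule s_poly_difference_eq_sum)
  have 2: "(m + 1)^2 * (s_poly (Suc (Suc n)) x - s_poly (Suc n) x) = L * (E + s_poly (Suc n) x)"
    using s_poly_difference_eq_sum[of "Suc n" x] unfolding E_def L_def m_def
    by (simp add: algebra_simps)
  have "m^2 * (s_poly n x)\<^sup>2 + L * E * (s_poly n x - E) + (2 * m + 1) * (s_poly (Suc n) x)\<^sup>2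
      = (m + 1)^2 * (s_poly (Suc n) x)\<^sup>2 - (m^2 * (s_poly (Suc n) x - s_poly n x)) * (s_poly (Suc n) x + s_poly n x)
         + L * E * (s_poly n x - E)"
    by (simp add: algebra_simps power2_eq_square)
  also have "\<dots> = (m + 1)^2 * (s_poly (Suc n) x)\<^sup>2 + L * (E + s_poly (Suc n) x) * (s_poly (Suc n) x - (E + s_poly (Suc n) x))"
    unfolding 1 by (simp add: algebra_simps)
  also have "m^2 * (s_poly n x)\<^sup>2 + L * E * (s_poly n x - E) + (2 * m + 1) * (s_poly (Suc n) x)\<^sup>2
      = (\<Sum>k\<le>Suc n. of_nat (2 * k + 1) * (s_poly k x)\<^sup>2)"
    using Suc.IH [folded m_def E_def, unfolded 1] by (simp add: m_def)
  finally show ?case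
    using 2 by (simp add: E_def m_def add.commute)
qed

section \<open>\<open>p\<close>-adic integers and congruences\<close>

lemma padic_Ints_0 [simp]: "0 \<in> \<int>\<^sub>p"
  unfolding padic_Ints_def by (metis rangeI to_fract_0)

lemma padic_Ints_1 [simp]: "1 \<in> \<int>\<^sub>p"
  unfolding padic_Ints_def by (metis rangeI to_fract_1)

lemma padic_Ints_add: "a \<in> \<int>\<^sub>p \<Longrightarrow> b \<in> \<int>\<^sub>p \<Longrightarrow> a + b \<in> \<int>\<^sub>p"
  unfolding padic_Ints_def by (metis (no_types, lifting) imageE rangeI to_fract_add)

lemma padic_Ints_diff: "a \<in> \<int>\<^sub>p \<Longrightarrow> b \<in> \<int>\<^sub>p \<Longrightarrow> a - b \<in> \<int>\<^sub>p"
  unfolding padic_Ints_def by (metis (no_types, lifting) imageE rangeI to_fract_diff)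

lemma padic_Ints_mult: "a \<in> \<int>\<^sub>p \<Longrightarrow> b \<in> \<int>\<^sub>p \<Longrightarrow> a * b \<in> \<int>\<^sub>p"
  unfolding padic_Ints_def by (metis (no_types, lifting) imageE rangeI to_fract_mult)

lemma padic_Ints_of_nat [simp]: "of_nat n \<in> \<int>\<^sub>p"
  by (induction n) (auto intro: padic_Ints_add)

lemma padic_Ints_numeral [simp]: "numeral n \<in> \<int>\<^sub>p"
  by (metis of_nat_numeral padic_Ints_of_nat)

lemma padic_Ints_uminus: "a \<in> \<int>\<^sub>p \<Longrightarrow> - a \<in> \<int>\<^sub>p"
  using padic_Ints_diff[of 0 a] by simp

lemma padic_Ints_power: "a \<in> \<int>\<^sub>p \<Longrightarrow> a ^ n \<in> \<int>\<^sub>p"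
  by (induction n) (auto intro: padic_Ints_mult)

lemma padic_Ints_sum: "(\<And>i. i \<in> A \<Longrightarrow> f i \<in> \<int>\<^sub>p) \<Longrightarrow> sum f A \<in> \<int>\<^sub>p"
  by (induction A rule: infinite_finite_induct) (auto intro: padic_Ints_add)

lemma padic_Ints_prod: "(\<And>i. i \<in> A \<Longrightarrow> f i \<in> \<int>\<^sub>p) \<Longrightarrow> prod f A \<in> \<int>\<^sub>p"
  by (induction A rule: infinite_finite_induct) (auto intro: padic_Ints_mult)

lemmas padic_Ints_intros =
  padic_Ints_add padic_Ints_diff padic_Ints_mult padic_Ints_uminus padic_Ints_power
  padic_Ints_sum padic_Ints_prod

section \<open>Units and divisibility by p in the ring of p-adic integers\<close>

lemma Rep_padic_int_bounds:
  "0 \<le> Rep_padic_int (x :: 'p :: prime_card padic_int) n" "Rep_padic_int x n < int CARD('p) ^ n"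
  using Rep_padic_int[of x] by auto

text \<open>Each residue is inverted separately. Inverses modulo \<open>p^n\<close> are unique, so
  the choices form a coherent sequence.\<close>

lemma padic_int_unit:
  fixes y :: "'p :: prime_card padic_int"
  assumes "Rep_padic_int y 1 \<noteq> 0"
  shows "\<exists>z. y * z = 1"
proof -
  let ?p = "int CARD('p)"
  have cop: "coprime (Rep_padic_int y n) (?p ^ n)" for n
  proof (cases n)
    case (Suc m)
    have "Rep_padic_int y n mod ?p = Rep_padic_int y 1"
      using padic_int_residue_mod[of 1 n y] Suc by simp
    with assms have "\<not> ?p dvd Rep_padic_int y n"
      by (simp add: dvd_eq_mod_eq_0)
    then show ?thesis
      by (metis coprime_commute coprime_power_left_iff prime_card_int prime_imp_coprime)
  qed simp
  have "\<exists>b. b \<in> {0..<?p ^ n} \<and> cong (Rep_padic_int y n * b) 1 (?p ^ n)" for n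
  proof -
    obtain b where "cong (Rep_padic_int y n * b) 1 (?p ^ n)"
      using cop cong_solve_coprime_int by blast
    then have "b mod ?p ^ n \<in> {0..<?p ^ n} \<and> cong (Rep_padic_int y n * (b mod ?p ^ n)) 1 (?p ^ n)"
      by (simp add: cong_def mod_simps)
    then show ?thesis by blast
  qed
  then obtain g where g: "\<And>n. g n \<in> {0..<?p ^ n}" "\<And>n. cong (Rep_padic_int y n * g n) 1 (?p ^ n)"
    by metis
  have coh: "g (Suc n) mod ?p ^ n = g n" for n
  proof -
    have "cong (Rep_padic_int y (Suc n) * g (Suc n)) 1 (?p ^ n)"
      using g(2)[of "Suc n"] by (rule cong_dvd_modulus) simp
    moreover have "cong (Rep_padic_int y (Suc n)) (Rep_padic_int y n) (?p ^ n)"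
      using padic_int_residue_mod[of n "Suc n" y] padic_int_residue_mod[of n n y] by (simp add: cong_def)
    ultimately have "cong (Rep_padic_int y n * g (Suc n)) 1 (?p ^ n)"
      by (metis cong_scalar_right cong_sym cong_trans)
    with g(2) have "cong (Rep_padic_int y n * g (Suc n)) (Rep_padic_int y n * g n) (?p ^ n)"
      using cong_sym cong_trans by blast
    then have "cong (g (Suc n)) (g n) (?p ^ n)"
      using cop cong_mult_lcancel by blast
    then show ?thesis
      using g(1)[of n] by (simp add: cong_def)
  qed
  have "Rep_padic_int (Abs_padic_int g :: 'p padic_int) = g"
    by (rule Abs_padic_int_inverse) (use g(1) coh in auto)
  then have "y * Abs_padic_int g = 1"
    using g(2)
    by (auto simp: Rep_padic_int_inject [symmetric] times_padic_int.rep_eq one_padic_int.rep_eq cong_def)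
  then show ?thesis by blast
qed

lemma padic_int_dvd:
  fixes y :: "'p :: prime_card padic_int"
  assumes "Rep_padic_int y 1 = 0"
  shows "\<exists>z. y = of_nat CARD('p) * z"
proof -
  let ?p = "int CARD('p)"
  \<comment> \<open>Division by \<open>p\<close> loses one power, so residue \<open>n\<close> of the
    quotient comes from residue \<open>n + 1\<close> of \<open>y\<close>.\<close>
  define g where "g n = Rep_padic_int y (Suc n) div ?p" for n
  have g: "Rep_padic_int y (Suc n) = ?p * g n" for n
  proof -
    have "Rep_padic_int y (Suc n) mod ?p = 0"
      using padic_int_residue_mod[of 1 "Suc n" y] assms by simp
    then show ?thesis by (simp add: g_def mult_div_mod_eq mod_0_imp_dvd)
  qed
  have "g n \<in> {0..<?p ^ n}" for n
    using Rep_padic_int_bounds[of y "Suc n"] by (simp add: g zero_le_mult_iff order.strict_iff_not)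
  moreover have "g (Suc n) mod ?p ^ n = g n" for n
  proof -
    have "?p * g n = (?p * g (Suc n)) mod (?p * ?p ^ n)"
      using padic_int_residue_mod[of "Suc n" "Suc (Suc n)" y] by (simp add: g)
    also have "\<dots> = ?p * (g (Suc n) mod ?p ^ n)"
      by (rule mod_mult_mult1)
    finally show ?thesis by simp
  qed
  ultimately have "Rep_padic_int (Abs_padic_int g :: 'p padic_int) = g"
    by (intro Abs_padic_int_inverse) auto
  then have "Rep_padic_int (of_nat CARD('p) * Abs_padic_int g :: 'p padic_int) n = Rep_padic_int y n" for n
    using padic_int_residue_mod[of n "Suc n" y]
    by (simp add: times_padic_int.rep_eq padic_int_of_nat_residue mod_simps flip: g)
  then have "y = of_nat CARD('p) * Abs_padic_int g"
    by (auto simp: Rep_padic_int_inject [symmetric])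
  then show ?thesis by blast
qed

section \<open>The ideals generated by the powers of p; units and residues\<close>

lemma to_fract_of_nat [simp]: "to_fract (of_nat n) = of_nat n"
  by (induction n) auto

text \<open>\<open>p^m\<close> times the p-adic integers, as a subset of the field: congruences
  modulo powers of \<open>p\<close> become closure properties of these sets.\<close>

definition padic_ideal :: "nat \<Rightarrow> 'p :: prime_card padic set"
  where "padic_ideal m = {a. a / of_nat CARD('p) ^ m \<in> \<int>\<^sub>p}"

lemma le_CARD_minus_1_iff [simp]: "i \<le> CARD('p :: prime_card) - Suc 0 \<longleftrightarrow> i < CARD('p)"
  using prime_gt_0_nat[OF prime_card[where 'a='p]] by linarith

lemma padic_ideal_0: "padic_ideal 0 = \<int>\<^sub>p"
  by (simp add: padic_ideal_def)

lemma padic_cong_iff: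
  "[a \<equiv> b] (mod (CARD('p) ^ m)) \<longleftrightarrow> a - (b :: 'p :: prime_card padic) \<in> padic_ideal m"
  by (simp add: padic_cong_def padic_ideal_def)

lemma zero_in_padic_ideal [simp]: "0 \<in> padic_ideal m"
  by (simp add: padic_ideal_def)

lemma padic_ideal_add: "a \<in> padic_ideal m \<Longrightarrow> b \<in> padic_ideal m \<Longrightarrow> a + b \<in> padic_ideal m"
  by (simp add: padic_ideal_def add_divide_distrib padic_Ints_add)

lemma padic_ideal_diff: "a \<in> padic_ideal m \<Longrightarrow> b \<in> padic_ideal m \<Longrightarrow> a - b \<in> padic_ideal m"
  by (simp add: padic_ideal_def diff_divide_distrib padic_Ints_diff)

lemma padic_ideal_mult: "a \<in> padic_ideal m \<Longrightarrow> b \<in> padic_ideal n \<Longrightarrow> a * b \<in> padic_ideal (m + n)"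
  using padic_Ints_mult[of "a / _ ^ m" "b / _ ^ n"] by (simp add: padic_ideal_def power_add)

lemma padic_ideal_mult_1_1: "a \<in> padic_ideal 1 \<Longrightarrow> b \<in> padic_ideal 1 \<Longrightarrow> a * b \<in> padic_ideal 2"
  using padic_ideal_mult[of a 1 b 1] unfolding one_add_one .

lemma padic_ideal_mult_left: "a \<in> \<int>\<^sub>p \<Longrightarrow> b \<in> padic_ideal m \<Longrightarrow> a * b \<in> padic_ideal m"
  using padic_ideal_mult[of a 0 b m] by (simp add: padic_ideal_0)

lemma padic_ideal_mult_right: "a \<in> padic_ideal m \<Longrightarrow> b \<in> \<int>\<^sub>p \<Longrightarrow> a * b \<in> padic_ideal m"
  using padic_ideal_mult[of a m b 0] by (simp add: padic_ideal_0)

lemma padic_ideal_sum: "(\<And>i. i \<in> A \<Longrightarrow> f i \<in> padic_ideal m) \<Longrightarrow> sum f A \<in> padic_ideal m"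
  by (induction A rule: infinite_finite_induct) (auto intro: padic_ideal_add)

lemma CARD_power_in_padic_ideal [simp]: "of_nat CARD('p) ^ m \<in> (padic_ideal m :: 'p :: prime_card padic set)"
  by (simp add: padic_ideal_def)

lemma CARD_in_padic_ideal [simp]: "of_nat CARD('p) \<in> (padic_ideal (Suc 0) :: 'p :: prime_card padic set)"
  by (simp add: padic_ideal_def)

lemma padic_ideal_antimono:
  assumes "m \<le> n"
  shows "padic_ideal n \<subseteq> padic_ideal m"
proof
  fix a :: "'a padic"
  assume "a \<in> padic_ideal n"
  then have "a / of_nat CARD('a) ^ n * of_nat CARD('a) ^ (n - m) \<in> \<int>\<^sub>p"
    by (intro padic_Ints_intros) (simp_all add: padic_ideal_def)
  also have "a / of_nat CARD('a) ^ n * of_nat CARD('a) ^ (n - m) = a / of_nat CARD('a) ^ m"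
    using assms by (simp add: field_simps flip: power_add)
  finally show "a \<in> padic_ideal m" by (simp add: padic_ideal_def)
qed

text \<open>The p-adic integers form a local ring: the residue modulo \<open>p\<close> decides
  between the two cases.\<close>

lemma padic_unit_or_divisible:
  fixes a :: "'p :: prime_card padic"
  assumes "a \<in> \<int>\<^sub>p"
  shows "a \<in> padic_ideal 1 \<or> a \<noteq> 0 \<and> 1 / a \<in> \<int>\<^sub>p"
proof -
  obtain y where y: "a = to_fract y"
    using assms by (auto simp: padic_Ints_def)
  show ?thesis
  proof (cases "Rep_padic_int y 1 = 0")
    case True
    then obtain z where "y = of_nat CARD('p) * z"
      using padic_int_dvd by blast
    then have "a / of_nat CARD('p) = to_fract z"
      by (simp add: y)
    then show ?thesis by (simp add: padic_ideal_def padic_Ints_def)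
  next
    case False
    then obtain z where "y * z = 1"
      using padic_int_unit by blast
    then have "a * to_fract z = 1"
      unfolding y by (metis to_fract_1 to_fract_mult)
    moreover from this have "a \<noteq> 0" by auto
    ultimately have "1 / a = to_fract z" by (simp add: field_simps)
    with \<open>a \<noteq> 0\<close> show ?thesis by (simp add: padic_Ints_def)
  qed
qed

lemma padic_residue_exists:
  fixes x :: "'p :: prime_card padic"
  assumes "x \<in> \<int>\<^sub>p"
  shows "\<exists>r < CARD('p). x - of_nat r \<in> padic_ideal 1"
proof -
  obtain y where y: "x = to_fract y"
    using assms by (auto simp: padic_Ints_def)
  define r where "r = nat (Rep_padic_int y 1)"
  have r: "int r = Rep_padic_int y 1"
    using Rep_padic_int_bounds[of y 1] by (simp add: r_def)
  then have "r < CARD('p)"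
    using Rep_padic_int_bounds[of y 1] by simp
  moreover have "Rep_padic_int (y - of_nat r) 1 = 0"
    by (simp add: minus_padic_int.rep_eq padic_int_of_nat_residue r mod_simps)
  then obtain z where "y - of_nat r = of_nat CARD('p) * z"
    using padic_int_dvd by blast
  then have "x - of_nat r = of_nat CARD('p) * to_fract z"
    unfolding y by (metis to_fract_diff to_fract_mult to_fract_of_nat)
  then have "x - of_nat r \<in> padic_ideal 1"
    by (simp add: padic_ideal_def padic_Ints_def)
  ultimately show ?thesis by blast
qed

lemma of_nat_in_padic_ideal_iff:
  "(of_nat n :: 'p :: prime_card padic) \<in> padic_ideal (Suc 0) \<longleftrightarrow> CARD('p) dvd n"
proof
  assume "(of_nat n :: 'p padic) \<in> padic_ideal (Suc 0)"
  then obtain z where "(of_nat n :: 'p padic) / of_nat CARD('p) = to_fract z"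
    by (auto simp: padic_ideal_def padic_Ints_def)
  \<comment> \<open>Once the denominator is cleared, the equation descends to the ring, where the
    residue modulo \<open>p\<close> can be read off.\<close>
  then have "to_fract (of_nat n) = to_fract (of_nat CARD('p) * z)"
    by (simp add: field_simps)
  then have "(of_nat n :: 'p padic_int) = of_nat CARD('p) * z"
    by (simp only: to_fract_eq_iff)
  then have "Rep_padic_int (of_nat n :: 'p padic_int) 1 = 0"
    by (simp only: times_padic_int.rep_eq padic_int_of_nat_residue) simp
  then show "CARD('p) dvd n"
    by (simp add: padic_int_of_nat_residue flip: of_nat_mod dvd_eq_mod_eq_0)
next
  assume "CARD('p) dvd n"
  then show "(of_nat n :: 'p padic) \<in> padic_ideal (Suc 0)"
    by (auto simp: padic_ideal_def)
qed

lemma inverse_of_nat_in_padic_Ints: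
  assumes "\<not> CARD('p) dvd n"
  shows "1 / (of_nat n :: 'p :: prime_card padic) \<in> \<int>\<^sub>p"
  using padic_unit_or_divisible[of "of_nat n :: 'p padic"] assms of_nat_in_padic_ideal_iff by auto

lemma inverse_of_nat_less_in_padic_Ints:
  assumes "0 < n" "n < CARD('p)"
  shows "1 / (of_nat n :: 'p :: prime_card padic) \<in> \<int>\<^sub>p"
  using assms inverse_of_nat_in_padic_Ints nat_dvd_not_less by blast

section \<open>Arbitrary arguments\<close>

lemma padic_ideal_prod_diff:
  assumes "\<And>i. i \<in> A \<Longrightarrow> f i - g i \<in> padic_ideal m"
    and "\<And>i. i \<in> A \<Longrightarrow> f i \<in> \<int>\<^sub>p" and "\<And>i. i \<in> A \<Longrightarrow> g i \<in> \<int>\<^sub>p"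
  shows "prod f A - prod g A \<in> padic_ideal m"
  using assms
proof (induction A rule: infinite_finite_induct)
  case (insert a A)
  have "prod f (insert a A) - prod g (insert a A) = (f a - g a) * prod f A + g a * (prod f A - prod g A)"
    using insert.hyps by (simp add: algebra_simps)
  also have "\<dots> \<in> padic_ideal m"
    using insert by (intro padic_ideal_add padic_ideal_mult_left padic_ideal_mult_right padic_Ints_prod) auto
  finally show ?case .
qed auto

lemma padic_Ints_divide_of_nat:
  assumes "a \<in> \<int>\<^sub>p" "0 < n" "n < CARD('p)"
  shows "a / (of_nat n :: 'p :: prime_card padic) \<in> \<int>\<^sub>p"
  using padic_Ints_mult[OF assms(1) inverse_of_nat_less_in_padic_Ints[OF assms(2,3)]] by simp

lemma padic_ideal_divide_of_nat:
  assumes "a \<in> padic_ideal m" "0 < n" "n < CARD('p)"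
  shows "a / (of_nat n :: 'p :: prime_card padic) \<in> padic_ideal m"
  using padic_ideal_mult_right[OF assms(1) inverse_of_nat_less_in_padic_Ints[OF assms(2,3)]] by simp

lemma padic_ideal_of_nat_mult_cancel:
  assumes "of_nat n * a \<in> padic_ideal m" "0 < n" "n < CARD('p)"
  shows "(a :: 'p :: prime_card padic) \<in> padic_ideal m"
  using padic_ideal_divide_of_nat[OF assms] assms(2) by simp

text \<open>Dividing twice by a natural number instead of once by a square lets
  \<open>padic_Ints_divide_of_nat\<close> and \<open>padic_ideal_divide_of_nat\<close>
  apply.\<close>

lemma sfac_factor_eq:
  "((x :: 'a :: field_char_0) - of_nat i) * (x + of_nat i + 1) / (of_nat i + 1)\<^sup>2
     = (x - of_nat i) * (x + of_nat i + 1) / of_nat (Suc i) / of_nat (Suc i)"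
  by (simp only: power2_eq_square divide_divide_eq_left of_nat_Suc add.commute)

lemma sfac_in_padic_Ints:
  assumes "x \<in> \<int>\<^sub>p" "k < CARD('p)"
  shows "sfac k (x :: 'p :: prime_card padic) \<in> \<int>\<^sub>p"
  unfolding sfac_def sfac_factor_eq using assms
  by (intro padic_Ints_intros padic_Ints_divide_of_nat) auto

lemma sfac_diff_in_padic_ideal:
  fixes x :: "'p :: prime_card padic"
  assumes "y - x \<in> padic_ideal m" "x \<in> \<int>\<^sub>p" "y \<in> \<int>\<^sub>p" "k < CARD('p)"
  shows "sfac k y - sfac k x \<in> padic_ideal m"
  unfolding sfac_def
proof (rule padic_ideal_prod_diff)
  fix i assume i: "i \<in> {..<k}"
  have "(y - of_nat i) * (y + of_nat i + 1) / (of_nat i + 1)\<^sup>2 - (x - of_nat i) * (x + of_nat i + 1) / (of_nat i + 1)\<^sup>2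
     = (y - x) * (y + x + 1) / of_nat (Suc i) / of_nat (Suc i)"
    unfolding sfac_factor_eq diff_divide_distrib [symmetric] by (simp add: algebra_simps)
  also have "\<dots> \<in> padic_ideal m"
    using assms i
    by (intro padic_ideal_divide_of_nat padic_ideal_mult_right padic_Ints_intros) auto
  finally show "(y - of_nat i) * (y + of_nat i + 1) / (of_nat i + 1)\<^sup>2
       - (x - of_nat i) * (x + of_nat i + 1) / (of_nat i + 1)\<^sup>2 \<in> padic_ideal m" .
qed (unfold sfac_factor_eq, use assms in \<open>(intro padic_Ints_intros padic_Ints_divide_of_nat; force)+\<close>)

lemma s_poly_in_padic_Ints:
  assumes "x \<in> \<int>\<^sub>p" "n < CARD('p)"
  shows "s_poly n (x :: 'p :: prime_card padic) \<in> \<int>\<^sub>p"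
  unfolding s_poly_eq_sum[OF order_refl] using assms
  by (intro padic_Ints_sum padic_Ints_mult padic_Ints_of_nat sfac_in_padic_Ints) auto

lemma s_poly_diff_in_padic_ideal:
  fixes x :: "'p :: prime_card padic"
  assumes "y - x \<in> padic_ideal m" "x \<in> \<int>\<^sub>p" "y \<in> \<int>\<^sub>p" "n < CARD('p)"
  shows "s_poly n y - s_poly n x \<in> padic_ideal m"
  unfolding s_poly_eq_sum[OF order_refl] sum_subtractf [symmetric] right_diff_distrib [symmetric]
  using assms
  by (intro padic_ideal_sum padic_ideal_mult_left padic_Ints_of_nat sfac_diff_in_padic_ideal) auto

section \<open>Values at natural arguments modulo p\<close>

lemma s_poly_0_right [simp]: "s_poly n 0 = 1"
proof -
  have "sfac k (0 :: 'a) = (if k = 0 then 1 else 0)" for k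
    by (cases k) (auto simp: sfac_def prod.lessThan_Suc_shift)
  then have "s_poly n (0 :: 'a) = (\<Sum>k\<le>n. if k = 0 then 1 else 0)"
    unfolding s_poly_eq_sum[OF order_refl] by (intro sum.cong) auto
  then show ?thesis by simp
qed

text \<open>Modulo \<open>p\<close>, \<open>e ^ j\<close> solves the recurrence in the argument,
  because \<open>(j + 1)^2 - j^2 = 2 * j + 1\<close> and \<open>e\<^sup>2 = 1\<close>; below
  \<open>p\<close> the leading coefficient is invertible. It serves index \<open>p - 1\<close> with
  \<open>e = -1\<close> and index \<open>p\<close> with \<open>e = 1\<close>.\<close>

lemma s_poly_of_nat_mod_CARD:
  fixes e :: "'p :: prime_card padic"
  assumes "of_nat (2 * n + 1) - e \<in> padic_ideal 1" "e\<^sup>2 = 1" "e \<in> \<int>\<^sub>p" "j < CARD('p)"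
  shows "s_poly n (of_nat j) - e ^ j \<in> padic_ideal 1"
  using assms(4)
proof (induction j rule: less_induct)
  case (less j)
  show ?case
  proof (cases j)
    case 0
    then show ?thesis by simp
  next
    case (Suc i)
    define d where "d = (of_nat (2 * n + 1) :: 'p padic)"
    have IH: "s_poly n (of_nat i) - e ^ i \<in> padic_ideal 1"
      using less.IH[of i] less.prems Suc by simp
    have rec: "of_nat (j ^ 2) * s_poly n (of_nat j)
       = of_nat i ^ 2 * s_poly n (of_nat i - 1 :: 'p padic) + (2 * of_nat i + 1) * d * s_poly n (of_nat i)"
      using s_poly_recurrence_argument[of "of_nat i :: 'p padic" n]
      by (simp add: Suc d_def algebra_simps)
    have prev: "of_nat i ^ 2 * (s_poly n (of_nat i - 1) - e ^ j) \<in> padic_ideal 1"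
    \<comment> \<open>The induction hypothesis does not reach the argument \<open>-1\<close>; for
      \<open>i = 0\<close> the factor \<open>i^2\<close> removes it.\<close>
    proof (cases i)
      case 0
      then show ?thesis by simp
    next
      case i: (Suc h)
      have "e ^ j = e ^ h" using assms(2) by (simp add: Suc i power2_eq_square flip: mult.assoc)
      moreover have "s_poly n (of_nat h) - e ^ h \<in> padic_ideal 1"
        using less.IH[of h] less.prems Suc i by simp
      ultimately have "s_poly n (of_nat i - 1) - e ^ j \<in> padic_ideal 1"
        by (simp add: i)
      then show ?thesis by (intro padic_ideal_mult_left padic_Ints_power padic_Ints_of_nat)
    qed
    have "of_nat (j ^ 2) * (s_poly n (of_nat j) - e ^ j)
       = of_nat i ^ 2 * (s_poly n (of_nat i - 1) - e ^ j)
         + (2 * of_nat i + 1) * (d * (s_poly n (of_nat i) - e ^ i) + (d - e) * e ^ i)"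
      unfolding right_diff_distrib rec by (simp add: Suc algebra_simps power2_eq_square)
    also have "\<dots> \<in> padic_ideal 1"
    proof (rule padic_ideal_add[OF prev], rule padic_ideal_mult_left)
      show "2 * of_nat i + 1 \<in> (\<int>\<^sub>p :: 'p padic set)"
        by (intro padic_Ints_intros) simp_all
      have "d * (s_poly n (of_nat i) - e ^ i) \<in> padic_ideal 1"
        unfolding d_def by (intro padic_ideal_mult_left padic_Ints_of_nat IH)
      moreover have "(d - e) * e ^ i \<in> padic_ideal 1"
        unfolding d_def by (intro padic_ideal_mult_right padic_Ints_power assms)
      ultimately show "d * (s_poly n (of_nat i) - e ^ i) + (d - e) * e ^ i \<in> padic_ideal 1"
        by (rule padic_ideal_add)
    qed
    finally have "of_nat j * (of_nat j * (s_poly n (of_nat j) - e ^ j)) \<in> padic_ideal 1"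
      by (simp add: power2_eq_square mult.assoc)
    then show ?thesis
      using less.prems Suc by (meson padic_ideal_of_nat_mult_cancel zero_less_Suc)
  qed
qed

lemma s_poly_CARD_minus_1_mod:
  assumes "j < CARD('p)"
  shows "s_poly (CARD('p) - 1) (of_nat j) - (- 1) ^ j \<in> (padic_ideal 1 :: 'p :: prime_card padic set)"
proof (rule s_poly_of_nat_mod_CARD)
  have "of_nat (2 * (CARD('p) - 1) + 1) - (- 1 :: 'p padic) = 2 * of_nat CARD('p)"
    using prime_gt_0_nat[OF prime_card[where 'a='p]] by (simp add: of_nat_diff)
  also have "\<dots> \<in> padic_ideal 1"
    by (intro padic_ideal_mult_left) simp_all
  finally show "of_nat (2 * (CARD('p) - 1) + 1) - (- 1 :: 'p padic) \<in> padic_ideal 1" .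
qed (use assms in \<open>auto intro: padic_Ints_uminus\<close>)

lemma s_poly_CARD_mod:
  assumes "j < CARD('p)"
  shows "s_poly (CARD('p)) (of_nat j) - 1 \<in> (padic_ideal 1 :: 'p :: prime_card padic set)"
proof -
  have "of_nat (2 * CARD('p) + 1) - (1 :: 'p padic) = 2 * of_nat CARD('p)"
    by simp
  also have "\<dots> \<in> padic_ideal 1"
    by (intro padic_ideal_mult_left) simp_all
  finally show ?thesis
    using s_poly_of_nat_mod_CARD[of "CARD('p)" "1 :: 'p padic" j] assms by simp
qed

section \<open>Binomial coefficients (x choose p) for p-adic integers x\<close>

lemma binomial_CARD_minus_1_mod:
  assumes "r < CARD('p)"
  shows "(- 1) ^ r * of_nat (CARD('p) - 1 choose r) - 1 \<in> (padic_ideal 1 :: 'p :: prime_card padic set)"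
  using assms
proof (induction r)
  case (Suc r)
  \<comment> \<open>By Pascal's rule, consecutive signed binomials differ up to sign by
    \<open>p choose Suc r\<close>, a multiple of \<open>p\<close>.\<close>
  have "CARD('p) choose Suc r = (CARD('p) - 1 choose r) + (CARD('p) - 1 choose Suc r)"
    using prime_gt_0_nat[OF prime_card[where 'a='p]] by (metis Suc_pred' binomial_Suc_Suc)
  then have "(- 1) ^ Suc r * of_nat (CARD('p) - 1 choose Suc r) - 1
     = ((- 1) ^ r * of_nat (CARD('p) - 1 choose r) - 1)
       + (- 1) ^ Suc r * (of_nat (CARD('p) choose Suc r) :: 'p padic)"
    by (simp add: algebra_simps)
  also have "\<dots> \<in> padic_ideal 1"
    using Suc dvd_choose_prime[of "Suc r" "CARD('p)"] prime_card[where 'a='p]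
    by (intro padic_ideal_add padic_ideal_mult_left padic_Ints_intros)
       (auto simp: of_nat_in_padic_ideal_iff)
  finally show ?case .
qed simp

text \<open>The cofactor of \<open>(x - r) / p\<close> in \<open>x gchoose p\<close>. Its
  denominator is prime to \<open>p\<close>, and for odd \<open>p\<close> and \<open>x\<close>
  congruent to \<open>r\<close> its value is 1 modulo \<open>p\<close>.\<close>

definition punctured :: "nat \<Rightarrow> 'p :: prime_card padic \<Rightarrow> 'p padic"
  where "punctured r x = (\<Prod>l\<in>{..<CARD('p)} - {r}. x - of_nat l) / fact (CARD('p) - 1)"

lemma gbinomial_CARD:
  fixes x :: "'p :: prime_card padic"
  assumes "r < CARD('p)"
  shows "x gchoose CARD('p) = (x - of_nat r) / of_nat CARD('p) * punctured r x"
proof -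
  have "(\<Prod>l<CARD('p). x - of_nat l) = (x - of_nat r) * (\<Prod>l\<in>{..<CARD('p)} - {r}. x - of_nat l)"
    using assms by (intro prod.remove) auto
  moreover have "(fact (CARD('p)) :: 'p padic) = of_nat CARD('p) * fact (CARD('p) - 1)"
    using assms by (intro fact_reduce) simp
  ultimately show ?thesis
    by (simp add: gbinomial_prod_rev punctured_def flip: lessThan_atLeast0)
qed

lemma inverse_fact_in_padic_Ints: "1 / (fact (CARD('p) - 1) :: 'p :: prime_card padic) \<in> \<int>\<^sub>p"
proof -
  have "\<not> CARD('p) dvd fact (CARD('p) - 1)"
    using prime_card[where 'a='p] by (simp add: prime_dvd_fact_iff le_CARD_minus_1_iff[where 'p='p])
  then show ?thesis
    using inverse_of_nat_in_padic_Ints[where n = "fact (CARD('p) - 1)" and 'p='p] by simp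
qed

lemma punctured_in_padic_Ints:
  assumes "x \<in> \<int>\<^sub>p"
  shows "punctured r x \<in> \<int>\<^sub>p"
proof -
  have "(\<Prod>l\<in>{..<CARD('a)} - {r}. x - of_nat l) * (1 / fact (CARD('a) - 1)) \<in> \<int>\<^sub>p"
    by (intro padic_Ints_mult padic_Ints_prod padic_Ints_diff assms padic_Ints_of_nat inverse_fact_in_padic_Ints)
  then show ?thesis by (simp add: punctured_def)
qed

lemma punctured_diff_in_padic_ideal:
  assumes "y - x \<in> padic_ideal m" "x \<in> \<int>\<^sub>p" "y \<in> \<int>\<^sub>p"
  shows "punctured r y - punctured r x \<in> padic_ideal m"
proof -
  have "((\<Prod>l\<in>{..<CARD('a)} - {r}. y - of_nat l) - (\<Prod>l\<in>{..<CARD('a)} - {r}. x - of_nat l))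
      * (1 / fact (CARD('a) - 1)) \<in> padic_ideal m"
    using assms
    by (intro padic_ideal_mult_right padic_ideal_prod_diff inverse_fact_in_padic_Ints padic_Ints_diff) auto
  then show ?thesis by (simp add: punctured_def diff_divide_distrib)
qed

text \<open>The factors with \<open>l < r\<close> give \<open>fact r\<close>, those with
  \<open>l > r\<close> give \<open>fact (p - 1 - r)\<close> up to sign, so the value is the inverse
  of a signed binomial. The signs match because \<open>p - 1\<close> is even.\<close>

lemma punctured_of_nat:
  assumes "r < CARD('p)" "odd (CARD('p))"
  shows "(- 1) ^ r * of_nat (CARD('p) - 1 choose r) * punctured r (of_nat r) = (1 :: 'p :: prime_card padic)"
proof -
  let ?p = "CARD('p)"
  define s where "s = ?p - 1 - r"
  have "(\<Prod>l<r. of_nat r - of_nat l :: 'p padic) = (\<Prod>l<r. of_nat (Suc (r - Suc l)))"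
    by (intro prod.cong refl) (simp add: of_nat_diff)
  also have "\<dots> = (\<Prod>l<r. of_nat (Suc l))"
    by (rule prod.nat_diff_reindex)
  also have "\<dots> = fact r"
    by (simp add: fact_prod_Suc lessThan_atLeast0)
  finally have low: "(\<Prod>l<r. of_nat r - of_nat l :: 'p padic) = fact r" .
  have "(\<Prod>l\<in>{r<..<?p}. of_nat r - of_nat l :: 'p padic) = (\<Prod>i<s. - of_nat (Suc i))"
    by (rule prod.reindex_bij_witness[of _ "\<lambda>i. i + Suc r" "\<lambda>l. l - Suc r"])
       (use assms in \<open>auto simp: s_def of_nat_diff\<close>)
  also have "\<dots> = (- 1) ^ s * fact s"
    unfolding prod_uminus by (simp add: fact_prod_Suc lessThan_atLeast0)
  finally have high: "(\<Prod>l\<in>{r<..<?p}. of_nat r - of_nat l :: 'p padic) = (- 1) ^ s * fact s" .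
  have "{..<?p} - {r} = {..<r} \<union> {r<..<?p}"
    using assms by auto
  then have "(\<Prod>l\<in>{..<?p} - {r}. of_nat r - of_nat l :: 'p padic) = fact r * ((- 1) ^ s * fact s)"
    using prod.union_disjoint[of "{..<r}" "{r<..<?p}" "\<lambda>l. of_nat r - of_nat l :: 'p padic"]
    by (simp add: low high disjoint_iff)
  then have "punctured r (of_nat r :: 'p padic) = (- 1) ^ s * (fact r * fact s) / fact (?p - 1)"
    by (simp add: punctured_def)
  moreover have "(of_nat (?p - 1 choose r) :: 'p padic) = fact (?p - 1) / (fact r * fact s)"
    unfolding s_def using assms by (intro binomial_fact) auto
  moreover have "even (r + s)"
    using assms by (auto simp: s_def)
  then have "(- 1 :: 'p padic) ^ r * (- 1) ^ s = 1"
    by (simp flip: power_add)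
  ultimately show ?thesis
    by simp
qed

lemma punctured_mod_CARD:
  fixes x :: "'p :: prime_card padic"
  assumes "r < CARD('p)" "odd (CARD('p))" "x \<in> \<int>\<^sub>p" "x - of_nat r \<in> padic_ideal 1"
  shows "punctured r x - 1 \<in> padic_ideal 1"
proof -
  let ?c = "(- 1) ^ r * of_nat (CARD('p) - 1 choose r) :: 'p padic"
  have "punctured r x - 1 = (punctured r x - punctured r (of_nat r)) - (?c - 1) * punctured r (of_nat r)"
    using punctured_of_nat[OF assms(1,2)] by (simp add: left_diff_distrib)
  also have "\<dots> \<in> padic_ideal 1"
  proof (rule padic_ideal_diff)
    show "punctured r x - punctured r (of_nat r) \<in> padic_ideal 1"
      using assms by (intro punctured_diff_in_padic_ideal) auto
    show "(?c - 1) * punctured r (of_nat r) \<in> padic_ideal 1"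
      by (intro padic_ideal_mult_right binomial_CARD_minus_1_mod assms punctured_in_padic_Ints padic_Ints_of_nat)
  qed
  finally show ?thesis .
qed

text \<open>For natural \<open>x\<close> the quotient is \<open>x div p\<close>, and this is the
  case of Lucas' theorem with lower index \<open>p\<close>.\<close>

lemma gbinomial_CARD_mod:
  fixes x :: "'p :: prime_card padic"
  assumes "r < CARD('p)" "odd (CARD('p))" "x \<in> \<int>\<^sub>p" "x - of_nat r \<in> padic_ideal 1"
  shows "(x gchoose CARD('p)) - (x - of_nat r) / of_nat CARD('p) \<in> padic_ideal 1"
proof -
  have "(x gchoose CARD('p)) - (x - of_nat r) / of_nat CARD('p)
     = (x - of_nat r) / of_nat CARD('p) * (punctured r x - 1)"
    by (simp only: gbinomial_CARD[OF assms(1)] right_diff_distrib mult_1_right)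
  also have "\<dots> \<in> padic_ideal 1"
    using assms punctured_mod_CARD[OF assms]
    by (intro padic_ideal_mult_left) (auto simp: padic_ideal_def)
  finally show ?thesis .
qed

lemma gbinomial_CARD_in_padic_Ints:
  fixes x :: "'p :: prime_card padic"
  assumes "x \<in> \<int>\<^sub>p"
  shows "x gchoose CARD('p) \<in> \<int>\<^sub>p"
proof -
  obtain r where r: "r < CARD('p)" "x - of_nat r \<in> padic_ideal 1"
    using padic_residue_exists[OF assms] by blast
  then show ?thesis
    unfolding gbinomial_CARD[OF r(1)] using assms
    by (intro padic_Ints_mult punctured_in_padic_Ints) (auto simp: padic_ideal_def)
qed

text \<open>Adding \<open>p^2\<close> keeps the residue \<open>r\<close>, raises
  \<open>(x - r) / p\<close> by exactly \<open>p\<close>, and changes \<open>punctured\<close> by a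
  multiple of \<open>p^2\<close>.\<close>

lemma gbinomial_CARD_shift:
  fixes x :: "'p :: prime_card padic"
  assumes "odd (CARD('p))" "x \<in> \<int>\<^sub>p"
  defines "q \<equiv> (of_nat CARD('p) :: 'p padic)"
  shows "((x + q\<^sup>2) gchoose CARD('p)) - (x gchoose CARD('p)) - q \<in> padic_ideal 2"
proof -
  obtain r where r: "r < CARD('p)" "x - of_nat r \<in> padic_ideal 1"
    using padic_residue_exists[OF assms(2)] by blast
  define t where "t = (x - of_nat r) / q"
  have t: "t \<in> \<int>\<^sub>p" using r by (simp add: t_def q_def padic_ideal_def)
  have q: "q \<in> padic_ideal 1" "q ^ 2 \<in> padic_ideal 2" "q \<noteq> 0" "q \<in> \<int>\<^sub>p" by (simp_all add: q_def)
  have yI: "x + q\<^sup>2 \<in> \<int>\<^sub>p" using assms q by (intro padic_Ints_intros)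
  have y1: "x + q\<^sup>2 - of_nat r \<in> padic_ideal 1"
    using padic_ideal_add[OF r(2), of "q\<^sup>2"] q padic_ideal_antimono[of 1 2, where 'a='p] by (auto simp: algebra_simps)
  have "(x + q\<^sup>2 - of_nat r) / q = t + q"
    using q by (simp add: t_def field_simps power2_eq_square)
  then have "((x + q\<^sup>2) gchoose CARD('p)) - (x gchoose CARD('p)) - q
     = t * (punctured r (x + q\<^sup>2) - punctured r x) + q * (punctured r (x + q\<^sup>2) - 1)"
    by (simp add: gbinomial_CARD[OF r(1)] t_def algebra_simps flip: q_def)
  also have "\<dots> \<in> padic_ideal 2"
  proof (rule padic_ideal_add)
    show "t * (punctured r (x + q\<^sup>2) - punctured r x) \<in> padic_ideal 2"
      using t q yI assms by (intro padic_ideal_mult_left punctured_diff_in_padic_ideal) auto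
    show "q * (punctured r (x + q\<^sup>2) - 1) \<in> padic_ideal 2"
      by (rule padic_ideal_mult_1_1[OF q(1) punctured_mod_CARD[OF r(1) assms(1) yI y1]])
  qed
  finally show ?thesis .
qed

section \<open>The sums for arbitrary p-adic integer arguments modulo p^2\<close>

lemma s_poly_CARD_eq:
  "s_poly CARD('p) (x :: 'p :: prime_card padic)
     = (\<Sum>k\<le>CARD('p) - 1. of_nat (CARD('p) choose k) * sfac k x)
       + (x gchoose CARD('p)) * ((x + of_nat CARD('p)) gchoose CARD('p))"
proof -
  obtain m where "CARD('p) = Suc m"
    using prime_gt_0_nat[OF prime_card[where 'a='p]] gr0_implies_Suc by blast
  then show ?thesis
    unfolding s_poly_eq_sum[OF order_refl] sfac_eq_gbinomial by simp
qed

text \<open>Only the term \<open>k = p\<close> has \<open>p\<close> in its denominators; as a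
  product of two binomials it is still integral.\<close>

lemma s_poly_CARD_in_padic_Ints:
  assumes "x \<in> \<int>\<^sub>p"
  shows "s_poly CARD('p) (x :: 'p :: prime_card padic) \<in> \<int>\<^sub>p"
  unfolding s_poly_CARD_eq using assms
  by (intro padic_Ints_add padic_Ints_sum padic_Ints_mult padic_Ints_of_nat sfac_in_padic_Ints
       gbinomial_CARD_in_padic_Ints) auto

lemma sum_odd_weighted_s_poly_square_mod:
  assumes "x \<in> \<int>\<^sub>p"
  shows "(\<Sum>k\<le>CARD('p) - 1. of_nat (2 * k + 1) * (s_poly k (x :: 'p :: prime_card padic))\<^sup>2) \<in> padic_ideal 2"
proof -
  obtain m where m: "CARD('p) = Suc m"
    using prime_gt_0_nat[OF prime_card[where 'a='p]] gr0_implies_Suc by blast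
  have I: "k \<le> m \<Longrightarrow> s_poly k x \<in> \<int>\<^sub>p" for k
    using s_poly_in_padic_Ints[OF assms, of k] m by simp
  have S: "s_poly (Suc m) x \<in> \<int>\<^sub>p"
    using s_poly_CARD_in_padic_Ints[OF assms] m by simp
  have "(\<Sum>k\<le>m. of_nat (2 * k + 1) * (s_poly k x)\<^sup>2) \<in> padic_ideal 2"
    unfolding sum_odd_weighted_s_poly_square m [symmetric] mult.assoc using I S
    by (intro padic_ideal_add padic_ideal_mult_right padic_Ints_intros CARD_power_in_padic_ideal)
       (auto simp: m)
  then show ?thesis using m by simp
qed

text \<open>With \<open>y = x + p^2\<close>, Christoffel-Darboux leaves modulo \<open>p^2\<close>
  the product of \<open>s_poly (p - 1) x\<close>, which is \<open>(- 1) ^ r\<close> modulo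
  \<open>p\<close>, and the increment of \<open>s_poly p\<close>, which is
  \<open>p * (2 * t + 1) = p + 2 * (x - r)\<close>.\<close>

lemma sum_s_poly_square_mod:
  fixes x :: "'p :: prime_card padic"
  assumes "r < CARD('p)" "odd (CARD('p))" "x \<in> \<int>\<^sub>p" "x - of_nat r \<in> padic_ideal 1"
  shows "(2 * x + 1) * (\<Sum>k\<le>CARD('p) - 1. (s_poly k x)\<^sup>2)
           - (- 1) ^ r * (of_nat CARD('p) + 2 * (x - of_nat r)) \<in> padic_ideal 2"
proof -
  let ?p = "CARD('p)"
  obtain m where m: "?p = Suc m"
    using prime_gt_0_nat[OF prime_card[where 'a='p]] gr0_implies_Suc by blast
  define q where "q = (of_nat ?p :: 'p padic)"
  define y where "y = x + q\<^sup>2"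
  define C where "C = (\<lambda>z :: 'p padic. z gchoose ?p)"
  define t where "t = (x - of_nat r) / q"
  have q: "q \<in> padic_ideal 1" "q ^ 2 \<in> padic_ideal 2" "q \<noteq> 0" "q \<in> \<int>\<^sub>p" by (simp_all add: q_def)
  have t: "t \<in> \<int>\<^sub>p" using assms by (simp add: t_def q_def padic_ideal_def)
  have qt: "x - of_nat r = q * t" using q by (simp add: t_def)
  have yI: "y \<in> \<int>\<^sub>p" unfolding y_def using assms q by (intro padic_Ints_intros)
  have yx: "y - x \<in> padic_ideal 2" using q by (simp add: y_def)
  have I: "s_poly k x \<in> \<int>\<^sub>p" "s_poly k y \<in> \<int>\<^sub>p" "s_poly k y - s_poly k x \<in> padic_ideal 2" if "k \<le> m" for k
  proof -
    have "k < ?p" using m that by simp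
    then show "s_poly k x \<in> \<int>\<^sub>p" "s_poly k y \<in> \<int>\<^sub>p" "s_poly k y - s_poly k x \<in> padic_ideal 2"
      by (rule s_poly_in_padic_Ints[OF assms(3)] s_poly_in_padic_Ints[OF yI]
        s_poly_diff_in_padic_ideal[OF yx assms(3) yI])+
  qed
  have xq: "x + q \<in> \<int>\<^sub>p" "x + q - of_nat r \<in> padic_ideal 1" "(x + q - of_nat r) / q = t + 1"
    using padic_Ints_add[OF assms(3) q(4)] padic_ideal_add[OF assms(4) q(1)] q(3)
    by (simp_all add: t_def diff_divide_distrib add_divide_distrib algebra_simps)
  have CI: "C x \<in> \<int>\<^sub>p" "C (x + q) \<in> \<int>\<^sub>p" "C y \<in> \<int>\<^sub>p"
    unfolding C_def using assms yI xq by (auto intro: gbinomial_CARD_in_padic_Ints)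
  have Cx: "C x - t \<in> padic_ideal 1"
    using gbinomial_CARD_mod[OF assms] by (simp add: C_def t_def q_def)
  have Cxq: "C (x + q) - (t + 1) \<in> padic_ideal 1"
    using gbinomial_CARD_mod[OF assms(1,2) xq(1,2)] xq(3) by (simp add: C_def q_def)
  have sh1: "C y - C x - q \<in> padic_ideal 2"
    using gbinomial_CARD_shift[OF assms(2,3)] by (simp add: C_def y_def q_def)
  have sh2: "C (y + q) - C (x + q) - q \<in> padic_ideal 2"
    using gbinomial_CARD_shift[OF assms(2) xq(1)] by (simp add: C_def y_def q_def add_ac)
  have Cy: "C y - t \<in> padic_ideal 1"
  proof -
    have "C y - t = (C y - C x - q) + q + (C x - t)" by simp
    also have "\<dots> \<in> padic_ideal 1"
      using sh1 q Cx padic_ideal_antimono[of 1 2, where 'a='p] by (intro padic_ideal_add) auto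
    finally show ?thesis .
  qed
  have spC: "s_poly ?p z = (\<Sum>k\<le>?p - 1. of_nat (?p choose k) * sfac k z) + C z * C (z + q)" for z
    by (simp only: C_def q_def s_poly_CARD_eq)
  \<comment> \<open>The terms below \<open>p\<close> change by multiples of \<open>p^2\<close>. Both
    factors of \<open>C z * C (z + q)\<close> grow by \<open>q\<close> modulo \<open>p^2\<close>, so
    the product grows by \<open>q * (C y + C (x + q))\<close>, where the two values are
    \<open>t\<close> and \<open>t + 1\<close> modulo \<open>p\<close>.\<close>
  have sp: "s_poly ?p y - s_poly ?p x - q * (2 * t + 1) \<in> padic_ideal 2"
  proof -
    have "s_poly ?p y - s_poly ?p x - q * (2 * t + 1)
       = (\<Sum>k\<le>?p - 1. of_nat (?p choose k) * (sfac k y - sfac k x))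
         + (C y * (C (y + q) - C (x + q) - q) + C (x + q) * (C y - C x - q)
         + q * ((C y - t) + (C (x + q) - (t + 1))))"
      unfolding spC right_diff_distrib[of "of_nat _"] sum_subtractf
      by (simp add: algebra_simps)
    also have "\<dots> \<in> padic_ideal 2"
    proof (intro padic_ideal_add padic_ideal_sum)
      show "of_nat (?p choose k) * (sfac k y - sfac k x) \<in> padic_ideal 2" if "k \<in> {..?p - 1}" for k
        using that m yx assms yI by (intro padic_ideal_mult_left sfac_diff_in_padic_ideal) auto
      show "C y * (C (y + q) - C (x + q) - q) \<in> padic_ideal 2"
        using CI sh2 by (intro padic_ideal_mult_left)
      show "C (x + q) * (C y - C x - q) \<in> padic_ideal 2"
        using CI sh1 by (intro padic_ideal_mult_left)
      show "q * ((C y - t) + (C (x + q) - (t + 1))) \<in> padic_ideal 2"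
        by (rule padic_ideal_mult_1_1[OF q(1) padic_ideal_add[OF Cy Cxq]])
    qed
    finally show ?thesis .
  qed
  have sm: "s_poly m x - (- 1) ^ r \<in> padic_ideal 1"
  proof -
    have "s_poly m x - (- 1) ^ r = (s_poly m x - s_poly m (of_nat r)) + (s_poly m (of_nat r) - (- 1) ^ r)"
      by simp
    also have "\<dots> \<in> padic_ideal 1"
      using s_poly_CARD_minus_1_mod[OF assms(1)] assms m
      by (intro padic_ideal_add s_poly_diff_in_padic_ideal) auto
    finally show ?thesis .
  qed
  \<comment> \<open>\<open>y * (y + 1) - x * (x + 1) = q^2 * (2 * x + 1 + q^2)\<close>. The identity
    is exact, so cancelling \<open>q^2\<close> loses no precision.\<close>
  have "q\<^sup>2 * ((2 * x + 1 + q\<^sup>2) * (\<Sum>k\<le>m. s_poly k x * s_poly k y))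
      = - ((x * (x + 1) - y * (y + 1)) * (\<Sum>k\<le>m. s_poly k x * s_poly k y))"
    by (simp add: y_def algebra_simps power2_eq_square)
  also have "\<dots> = q\<^sup>2 * (s_poly ?p y * s_poly m x - s_poly ?p x * s_poly m y)"
    unfolding s_poly_Christoffel_Darboux m q_def by (simp add: algebra_simps)
  finally have CD: "(2 * x + 1 + q\<^sup>2) * (\<Sum>k\<le>m. s_poly k x * s_poly k y)
      = s_poly ?p y * s_poly m x - s_poly ?p x * s_poly m y"
    using q by simp
  have "(2 * x + 1) * (\<Sum>k\<le>m. (s_poly k x)\<^sup>2) - (- 1) ^ r * (q + 2 * (x - of_nat r))
     = ((2 * x + 1 + q\<^sup>2) * (\<Sum>k\<le>m. s_poly k x * s_poly k y) - (- 1) ^ r * (q * (2 * t + 1)))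
       - (2 * x + 1) * (\<Sum>k\<le>m. s_poly k x * (s_poly k y - s_poly k x))
       - q\<^sup>2 * (\<Sum>k\<le>m. s_poly k x * s_poly k y)"
    unfolding qt by (simp add: algebra_simps power2_eq_square sum_subtractf)
  also have "(2 * x + 1 + q\<^sup>2) * (\<Sum>k\<le>m. s_poly k x * s_poly k y) - (- 1) ^ r * (q * (2 * t + 1))
     = (s_poly ?p y - s_poly ?p x - q * (2 * t + 1)) * s_poly m x
       - s_poly ?p x * (s_poly m y - s_poly m x)
       + q * (s_poly m x - (- 1) ^ r) * (2 * t + 1)"
    unfolding CD by (simp add: algebra_simps)
  also have "\<dots> - (2 * x + 1) * (\<Sum>k\<le>m. s_poly k x * (s_poly k y - s_poly k x))
       - q\<^sup>2 * (\<Sum>k\<le>m. s_poly k x * s_poly k y) \<in> padic_ideal 2"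
  proof (intro padic_ideal_add padic_ideal_diff)
    show "(s_poly ?p y - s_poly ?p x - q * (2 * t + 1)) * s_poly m x \<in> padic_ideal 2"
      using sp I by (intro padic_ideal_mult_right) auto
    show "s_poly ?p x * (s_poly m y - s_poly m x) \<in> padic_ideal 2"
      using I assms s_poly_CARD_in_padic_Ints by (intro padic_ideal_mult_left) auto
    show "q * (s_poly m x - (- 1) ^ r) * (2 * t + 1) \<in> padic_ideal 2"
      by (intro padic_ideal_mult_right[OF padic_ideal_mult_1_1[OF q(1) sm]] padic_Ints_intros t) simp_all
    show "(2 * x + 1) * (\<Sum>k\<le>m. s_poly k x * (s_poly k y - s_poly k x)) \<in> padic_ideal 2"
      using I assms by (intro padic_ideal_mult_left padic_ideal_sum padic_Ints_intros) auto
    show "q\<^sup>2 * (\<Sum>k\<le>m. s_poly k x * s_poly k y) \<in> padic_ideal 2"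
      using I q by (intro padic_ideal_mult_right padic_Ints_intros) auto
  qed
  finally show ?thesis by (simp add: m q_def)
qed

section \<open>Natural arguments\<close>

text \<open>A basis of the polynomials invariant under \<open>n\<close> to \<open>-1 - n\<close>,
  monic of degree \<open>2 * k\<close>; each factor equals
  \<open>(n - i) * (n + i + 1)\<close>.\<close>

definition even_basis :: "nat \<Rightarrow> 'a :: field_char_0 poly"
  where "even_basis k = (\<Prod>i<k. [:0, 1, 1:] - [:of_nat (i * (i + 1)):])"

text \<open>A polynomial in the square of \<open>N\<close>: times \<open>N\<close> it is the product
  of the numbers from \<open>N - k\<close> to \<open>N + k\<close>, over the sole denominator
  \<open>2 * k + 1\<close>.\<close>

definition even_basis_sum :: "nat \<Rightarrow> 'a :: field_char_0 poly"
  where "even_basis_sum k = smult (1 / of_nat (2 * k + 1)) (\<Prod>i<k. [:0, 1:] - [:of_nat ((i + 1) ^ 2):])"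

lemma poly_even_basis:
  "poly (even_basis k) z = (\<Prod>i<k. (z - of_nat i) * (z + of_nat i + 1))"
  by (auto simp: even_basis_def poly_prod algebra_simps intro!: prod.cong)

lemma poly_even_basis_sum:
  "poly (even_basis_sum k) z = (\<Prod>i<k. z - (of_nat i + 1)\<^sup>2) / of_nat (2 * k + 1)"
  by (auto simp: even_basis_sum_def poly_prod power2_eq_square algebra_simps intro!: prod.cong)

text \<open>\<open>down\<close> and \<open>up\<close> write the product from \<open>N - k\<close> to
  \<open>N + k\<close>, and its shift by one, as multiples of the summand at \<open>N\<close>. The
  cofactors \<open>N - k\<close> and \<open>N + 1 + k\<close> differ by \<open>2 * k + 1\<close>, so
  the sum telescopes.\<close>

lemma sum_even_basis:
  "(\<Sum>n<N. poly (even_basis k) (of_nat n)) = of_nat N * poly (even_basis_sum k) (of_nat N ^ 2 :: 'a :: field_char_0)"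
proof -
  have down: "z * (\<Prod>i<k. z\<^sup>2 - (of_nat i + 1)\<^sup>2) = (z - of_nat k) * poly (even_basis k) z" for z :: 'a
    unfolding poly_even_basis
  proof (induction k)
    case (Suc k)
    have "z * (\<Prod>i<Suc k. z\<^sup>2 - (of_nat i + 1)\<^sup>2)
        = (z * (\<Prod>i<k. z\<^sup>2 - (of_nat i + 1)\<^sup>2)) * ((z - of_nat k - 1) * (z + of_nat k + 1))"
      by (simp add: power2_eq_square algebra_simps)
    then show ?case unfolding Suc.IH by (simp add: mult_ac diff_diff_eq add_ac)
  qed simp
  have up: "(z + 1) * (\<Prod>i<k. (z + 1)\<^sup>2 - (of_nat i + 1)\<^sup>2) = (z + 1 + of_nat k) * poly (even_basis k) z" for z :: 'a
    unfolding poly_even_basis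
  proof (induction k)
    case (Suc k)
    have "(z + 1) * (\<Prod>i<Suc k. (z + 1)\<^sup>2 - (of_nat i + 1)\<^sup>2)
        = ((z + 1) * (\<Prod>i<k. (z + 1)\<^sup>2 - (of_nat i + 1)\<^sup>2)) * ((z - of_nat k) * (z + 1 + of_nat (Suc k)))"
      by (simp add: power2_eq_square algebra_simps)
    then show ?case unfolding Suc.IH by (simp add: mult_ac add_ac)
  qed simp
  have nz: "(of_nat (2 * k + 1) :: 'a) \<noteq> 0" unfolding of_nat_eq_0_iff by simp
  have "of_nat (2 * k + 1) * (\<Sum>n<N. poly (even_basis k) (of_nat n)) = of_nat N * (\<Prod>i<k. (of_nat N :: 'a)\<^sup>2 - (of_nat i + 1)\<^sup>2)"
  proof (induction N)
    case (Suc N)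
    have "of_nat (2 * k + 1) * (\<Sum>n<Suc N. poly (even_basis k) (of_nat n))
        = (of_nat N - of_nat k) * poly (even_basis k) (of_nat N :: 'a) + of_nat (2 * k + 1) * poly (even_basis k) (of_nat N)"
      using Suc by (simp only: sum.lessThan_Suc distrib_left down)
    also have "\<dots> = (of_nat N + 1 + of_nat k) * poly (even_basis k) (of_nat N)"
      by (simp add: algebra_simps)
    finally show ?case
      unfolding up [symmetric] by (simp add: add.commute)
  qed simp
  then show ?thesis
    unfolding poly_even_basis_sum times_divide_eq_right nonzero_eq_divide_eq[OF nz] by (simp only: mult.commute)
qed

text \<open>This is \<open>(2 * n + 1)^2 = 4 * (n - k) * (n + k + 1) + (2 * k + 1)^2\<close>; the
  coefficients are integers.\<close>

lemma odd_square_times_even_basis: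
  "[:1, 4, 4:] * even_basis k
     = smult 4 (even_basis (Suc k)) + smult (of_nat (4 * k * (k + 1) + 1)) (even_basis k :: 'a :: field_char_0 poly)"
  by (rule poly_eq_poly_eq_iff[THEN iffD1], rule ext) (simp add: poly_even_basis algebra_simps)

text \<open>Membership in \<open>integral_even d\<close> says that the polynomial is invariant under
  \<open>n \<mapsto> - 1 - n\<close>, has degree at most \<open>2 * d\<close>, and is \<open>p\<close>-integral.\<close>

definition integral_even :: "nat \<Rightarrow> 'p :: prime_card padic poly set"
  where "integral_even d = {f. \<exists>c. (\<forall>k. c k \<in> \<int>\<^sub>p) \<and> f = (\<Sum>k\<le>d. smult (c k) (even_basis k))}"

lemma integral_even_add:
  assumes "f \<in> integral_even d" "g \<in> integral_even d"
  shows "f + g \<in> integral_even d"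
proof -
  obtain a b where "\<forall>k. a k \<in> \<int>\<^sub>p" "f = (\<Sum>k\<le>d. smult (a k) (even_basis k))"
      "\<forall>k. b k \<in> \<int>\<^sub>p" "g = (\<Sum>k\<le>d. smult (b k) (even_basis k))"
    using assms by (auto simp: integral_even_def)
  then show ?thesis
    by (auto simp: integral_even_def smult_add_left sum.distrib padic_Ints_add intro!: exI[of _ "\<lambda>k. a k + b k"])
qed

lemma integral_even_smult:
  assumes "f \<in> integral_even d" "a \<in> \<int>\<^sub>p"
  shows "smult a f \<in> integral_even d"
proof -
  obtain c where "\<forall>k. c k \<in> \<int>\<^sub>p" "f = (\<Sum>k\<le>d. smult (c k) (even_basis k))"
    using assms by (auto simp: integral_even_def)
  then show ?thesis
    using assms by (auto simp: integral_even_def smult_sum2 padic_Ints_mult intro!: exI[of _ "\<lambda>k. a * c k"])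
qed

lemma integral_even_mono:
  assumes "d \<le> e"
  shows "integral_even d \<subseteq> integral_even e"
proof
  fix f :: "'a padic poly"
  assume "f \<in> integral_even d"
  then obtain c where c: "\<forall>k. c k \<in> \<int>\<^sub>p" "f = (\<Sum>k\<le>d. smult (c k) (even_basis k))"
    by (auto simp: integral_even_def)
  have "f = (\<Sum>k\<le>e. smult (if k \<le> d then c k else 0) (even_basis k))"
    unfolding c(2) by (rule sum.mono_neutral_cong_left) (use assms in auto)
  then show "f \<in> integral_even e"
    using c(1) by (auto simp: integral_even_def intro!: exI[of _ "\<lambda>k. if k \<le> d then c k else 0"])
qed

lemma even_basis_in_integral_even: "k \<le> d \<Longrightarrow> even_basis k \<in> integral_even d"
  by (auto simp: integral_even_def intro!: exI[of _ "\<lambda>i. if i = k then 1 else 0"]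
      simp: if_distrib[of "\<lambda>a. smult a _"] sum.delta cong: if_cong)

lemma one_in_integral_even: "1 \<in> integral_even d"
  using even_basis_in_integral_even[of 0 d] by (simp add: even_basis_def)

lemma integral_even_sum: "(\<And>i. i \<in> A \<Longrightarrow> f i \<in> integral_even d) \<Longrightarrow> sum f A \<in> integral_even d"
proof (induction A rule: infinite_finite_induct)
  case (insert a A)
  then show ?case by (auto intro: integral_even_add)
qed (use integral_even_smult[OF one_in_integral_even padic_Ints_0] in simp_all)

lemma integral_even_odd_square:
  assumes "f \<in> integral_even d"
  shows "[:1, 4, 4:] * f \<in> integral_even (Suc d)"
proof -
  obtain c where c: "\<forall>k. c k \<in> \<int>\<^sub>p" "f = (\<Sum>k\<le>d. smult (c k) (even_basis k))"
    using assms by (auto simp: integral_even_def)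
  have "[:1, 4, 4:] * f = (\<Sum>k\<le>d. smult (c k) ([:1, 4, 4:] * even_basis k))"
    unfolding c(2) sum_distrib_left by (simp only: mult_smult_right)
  also have "\<dots> \<in> integral_even (Suc d)"
    unfolding odd_square_times_even_basis using c(1)
    by (intro integral_even_sum integral_even_smult integral_even_add even_basis_in_integral_even padic_Ints_of_nat) auto
  finally show ?thesis .
qed

text \<open>\<open>s_poly n j\<close> is a polynomial of degree \<open>j\<close> in \<open>n\<close> with the parity of \<open>j\<close> under
  \<open>n \<mapsto> - 1 - n\<close>; \<open>s_even_part j\<close> is what remains after splitting off \<open>2 * n + 1\<close> for odd \<open>j\<close>.\<close>

fun s_even_part :: "nat \<Rightarrow> 'a :: field_char_0 poly" where
  "s_even_part 0 = 1"
| "s_even_part (Suc 0) = 1"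
| "s_even_part (Suc (Suc j)) = smult (1 / of_nat (Suc (Suc j)) / of_nat (Suc (Suc j)))
     (smult (of_nat (2 * j + 3)) ((if even j then [:1, 4, 4:] else 1) * s_even_part (Suc j))
      + smult (of_nat (Suc j ^ 2)) (s_even_part j))"

definition s_index_poly :: "nat \<Rightarrow> 'a :: field_char_0 poly"
  where "s_index_poly j = [:1, 2:] ^ (j mod 2) * s_even_part j"

text \<open>Follows the recurrence in the argument. For even \<open>j\<close> its factor
  \<open>2 * n + 1\<close> meets the one of the odd neighbour, which gives the square
  \<open>[:1, 4, 4:]\<close>; for odd \<open>j\<close> one factor \<open>2 * n + 1\<close> is common
  to all terms.\<close>

lemma poly_s_index_poly: "poly (s_index_poly j) (of_nat n) = s_poly n (of_nat j :: 'a :: field_char_0)"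
proof (induction j rule: s_even_part.induct)
  case 1
  then show ?case by (simp add: s_index_poly_def)
next
  case 2
  then show ?case
    using s_poly_recurrence_argument[of "0 :: 'a" n] by (simp add: s_index_poly_def)
next
  case (3 j)
  let ?m = "of_nat (Suc (Suc j)) :: 'a"
  have nz: "?m \<noteq> 0" unfolding of_nat_eq_0_iff by simp
  have "?m ^ 2 * poly (s_index_poly (Suc (Suc j))) (of_nat n)
     = of_nat (2 * j + 3) * (2 * of_nat n + 1) * poly (s_index_poly (Suc j)) (of_nat n)
       + of_nat (Suc j ^ 2) * poly (s_index_poly j) (of_nat n)"
  proof -
    have "?m ^ 2 * poly (s_even_part (Suc (Suc j))) z =
       of_nat (2 * j + 3) * (poly (if even j then [:1, 4, 4:] else 1) z * poly (s_even_part (Suc j)) z)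
      + of_nat (Suc j ^ 2) * poly (s_even_part j) z" for z :: 'a
      using nz by (simp only: s_even_part.simps poly_smult poly_add poly_mult power2_eq_square) (simp add: divide_simps)
    note rec = this[of "of_nat n"]
    have w: "poly [:1, 2:] z = 2 * z + 1" "poly [:1, 4, 4:] z = (2 * z + 1) * (2 * z + 1)" for z :: 'a
      by (simp_all add: algebra_simps)
    show ?thesis
    proof (cases "even j")
      case True
      then have "j mod 2 = 0" "Suc j mod 2 = 1" "Suc (Suc j) mod 2 = 0" by presburger+
      then show ?thesis
        using rec True by (simp only: s_index_poly_def poly_mult poly_power w power_0 power_one_right mult_1 if_True mult_ac)
    next
      case False
      then have "j mod 2 = 1" "Suc j mod 2 = 0" "Suc (Suc j) mod 2 = 1" by presburger+
      moreover have "?m ^ 2 * ((2 * of_nat n + 1) * poly (s_even_part (Suc (Suc j))) (of_nat n))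
          = (2 * of_nat n + 1) * (of_nat (2 * j + 3) * poly (s_even_part (Suc j)) (of_nat n)
             + of_nat (Suc j ^ 2) * poly (s_even_part j) (of_nat n))"
        using rec False by (simp only: mult.left_commute[of "?m ^ 2"] if_False poly_1 mult_1)
      ultimately show ?thesis
        by (simp only: s_index_poly_def poly_mult poly_power w power_0 power_one_right mult_1) (simp only: distrib_left mult_ac)
    qed
  qed
  also have "\<dots> = ?m ^ 2 * s_poly n ?m"
    using s_poly_recurrence_argument[of "of_nat (Suc j) :: 'a" n]
    by (simp add: 3 algebra_simps)
  finally show ?case using nz by simp
qed

text \<open>The multiplier \<open>f\<close> makes products of two even parts accessible: the
  recursion only needs closure under sums, integral scalars and \<open>(2 * n + 1)^2\<close>. The
  denominators are units since \<open>j < p\<close>.\<close>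

lemma s_even_part_mult_integral_even:
  assumes "f \<in> integral_even d" "j < CARD('p)"
  shows "s_even_part j * f \<in> (integral_even (d + j div 2) :: 'p :: prime_card padic poly set)"
  using assms(2)
proof (induction j rule: s_even_part.induct)
  case (3 j)
  have "s_even_part (Suc j) * f \<in> integral_even (d + Suc j div 2)"
    using 3 by simp
  then have 1: "(if even j then [:1, 4, 4:] else 1) * s_even_part (Suc j) * f \<in> integral_even (d + Suc (Suc j) div 2)"
    using integral_even_odd_square[of "s_even_part (Suc j) * f" "d + Suc j div 2"]
    by (auto simp: mult.assoc elim!: oddE)
  have "s_even_part j * f \<in> integral_even (d + j div 2)"
    using 3 by simp
  then have 2: "s_even_part j * f \<in> integral_even (d + Suc (Suc j) div 2)"
    using integral_even_mono[of "d + j div 2" "d + Suc (Suc j) div 2", where 'a='p] by auto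
  have "s_even_part (Suc (Suc j)) * f = smult (1 / of_nat (Suc (Suc j)) / of_nat (Suc (Suc j)))
     (smult (of_nat (2 * j + 3)) ((if even j then [:1, 4, 4:] else 1) * s_even_part (Suc j) * f)
      + smult (of_nat (Suc j ^ 2)) (s_even_part j * f))"
    by (simp only: s_even_part.simps mult_smult_left distrib_right)
  also have "\<dots> \<in> integral_even (d + Suc (Suc j) div 2)"
    using 3(3) 1 2
    by (intro integral_even_smult integral_even_add padic_Ints_of_nat padic_Ints_divide_of_nat padic_Ints_1) auto
  finally show ?case .
qed (use assms in simp_all)

lemma s_index_poly_mult_integral_even:
  assumes "even (i + j)" "i < CARD('p)" "j < CARD('p)"
  shows "s_index_poly i * s_index_poly j \<in> (integral_even ((i + j) div 2) :: 'p :: prime_card padic poly set)"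
proof -
  have "s_even_part j \<in> (integral_even (j div 2) :: 'p padic poly set)"
    using s_even_part_mult_integral_even[OF one_in_integral_even[of 0] assms(3)] by simp
  from s_even_part_mult_integral_even[OF this assms(2)]
  have *: "s_even_part i * s_even_part j \<in> (integral_even (j div 2 + i div 2) :: 'p padic poly set)" .
  show ?thesis
  proof (cases "even i")
    case True
    then show ?thesis
      using * assms by (auto simp: s_index_poly_def add.commute elim!: evenE)
  next
    case False
    then have "s_index_poly i * s_index_poly j = [:1, 4, 4:] * (s_even_part i * s_even_part j :: 'p padic poly)"
    proof -
      have "[:1, 4, 4:] = [:1, 2:] * ([:1, 2:] :: 'p padic poly)" by simp
      moreover have "i mod 2 = 1" "j mod 2 = 1" using False assms by (auto simp: odd_iff_mod_2_eq_one)
      ultimately show ?thesis by (simp only: s_index_poly_def power_one_right mult_ac)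
    qed
    moreover have "Suc (j div 2 + i div 2) = (i + j) div 2"
      using False assms by (auto elim!: oddE)
    ultimately show ?thesis
      using integral_even_odd_square[OF *] by simp
  qed
qed

text \<open>The sums \<open>\<Sum>n<N. f n\<close> form an odd polynomial in \<open>N\<close>, whose coefficient at \<open>N\<close> is \<open>c\<close>.\<close>

definition has_linear_coeff :: "(nat \<Rightarrow> 'a :: field_char_0) \<Rightarrow> 'a \<Rightarrow> bool"
  where "has_linear_coeff f c \<longleftrightarrow>
    (\<exists>g. poly g 0 = c \<and> (\<forall>N. (\<Sum>n<N. f n) = of_nat N * poly g (of_nat N ^ 2)))"

lemma poly_eq_0_if_zero_at_nats:
  fixes h :: "'a :: field_char_0 poly"
  assumes "\<And>N. N > 0 \<Longrightarrow> poly h (of_nat N) = 0"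
  shows "h = 0"
proof (rule ccontr)
  assume "h \<noteq> 0"
  then have "finite {z. poly h z = 0}" by (rule poly_roots_finite)
  moreover have "of_nat ` {0<..} \<subseteq> {z. poly h z = 0}" using assms by auto
  ultimately have "finite (of_nat ` {0 :: nat<..} :: 'a set)" by (rule finite_subset[rotated])
  then have "finite {0 :: nat<..}" by (rule finite_imageD) (auto intro: inj_onI)
  then show False by (simp add: infinite_Ioi)
qed

lemma has_linear_coeff_unique:
  assumes "has_linear_coeff f c" "has_linear_coeff f d"
  shows "c = (d :: 'a :: field_char_0)"
proof -
  obtain g h where g: "poly g 0 = c" "\<And>N. (\<Sum>n<N. f n) = of_nat N * poly g (of_nat N ^ 2)"
    and h: "poly h 0 = d" "\<And>N. (\<Sum>n<N. f n) = of_nat N * poly h (of_nat N ^ 2)"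
    using assms unfolding has_linear_coeff_def by blast
  \<comment> \<open>Values are known only at squares, so both polynomials are first composed with
    the square.\<close>
  have "pcompose (g - h) [:0, 0, 1:] = 0"
  proof (rule poly_eq_0_if_zero_at_nats)
    fix N :: nat assume "N > 0"
    then show "poly (pcompose (g - h) [:0, 0, 1:]) (of_nat N :: 'a) = 0"
      using g(2)[of N] h(2)[of N] by (simp add: poly_pcompose power2_eq_square)
  qed
  then have "poly (pcompose (g - h) [:0, 0, 1:]) 0 = 0" by simp
  then show ?thesis using g(1) h(1) by (simp add: poly_pcompose)
qed

lemma has_linear_coeff_add:
  assumes "has_linear_coeff f c" "has_linear_coeff g d"
  shows "has_linear_coeff (\<lambda>n. f n + g n) (c + d)"
proof -
  obtain u v where "poly u 0 = c" "\<And>N. (\<Sum>n<N. f n) = of_nat N * poly u (of_nat N ^ 2)"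
    and "poly v 0 = d" "\<And>N. (\<Sum>n<N. g n) = of_nat N * poly v (of_nat N ^ 2)"
    using assms unfolding has_linear_coeff_def by blast
  then show ?thesis
    unfolding has_linear_coeff_def by (intro exI[of _ "u + v"]) (simp add: sum.distrib distrib_left)
qed

lemma has_linear_coeff_cmult:
  assumes "has_linear_coeff f c"
  shows "has_linear_coeff (\<lambda>n. a * f n) (a * c)"
proof -
  obtain u where "poly u 0 = c" "\<And>N. (\<Sum>n<N. f n) = of_nat N * poly u (of_nat N ^ 2)"
    using assms unfolding has_linear_coeff_def by blast
  then show ?thesis
    unfolding has_linear_coeff_def by (intro exI[of _ "smult a u"]) (simp add: mult.left_commute flip: sum_distrib_left)
qed

lemma has_linear_coeff_even_basis_sum:
  "has_linear_coeff (\<lambda>n. poly (\<Sum>k\<le>d. smult (c k) (even_basis k)) (of_nat n))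
     (\<Sum>k\<le>d. c k * poly (even_basis_sum k) (0 :: 'a :: field_char_0))"
  unfolding has_linear_coeff_def
proof (intro exI[of _ "\<Sum>k\<le>d. smult (c k) (even_basis_sum k)"] conjI allI)
  fix N
  have "(\<Sum>n<N. poly (\<Sum>k\<le>d. smult (c k) (even_basis k)) (of_nat n))
      = (\<Sum>k\<le>d. c k * (\<Sum>n<N. poly (even_basis k) (of_nat n)))"
    unfolding poly_sum poly_smult sum_distrib_left by (rule sum.swap)
  also have "\<dots> = of_nat N * poly (\<Sum>k\<le>d. smult (c k) (even_basis_sum k)) (of_nat N ^ 2)"
    unfolding sum_even_basis poly_sum poly_smult sum_distrib_left by (simp only: mult_ac)
  finally show "(\<Sum>n<N. poly (\<Sum>k\<le>d. smult (c k) (even_basis k)) (of_nat n))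
      = of_nat N * poly (\<Sum>k\<le>d. smult (c k) (even_basis_sum k)) (of_nat N ^ 2)" .
qed (simp add: poly_sum)

text \<open>Christoffel-Darboux becomes a polynomial identity in \<open>N\<close> whose right side
  has the factor \<open>N^2\<close>; hence \<open>L\<close> times the linear coefficient vanishes,
  and \<open>L\<close> is nonzero.\<close>

lemma has_linear_coeff_s_poly_orthogonal:
  assumes "even (i + j)" "i \<noteq> j" "i < CARD('p)" "j < CARD('p)"
  shows "has_linear_coeff (\<lambda>n. s_poly n (of_nat i) * s_poly n (of_nat j :: 'p :: prime_card padic)) 0"
proof -
  let ?S = "s_index_poly :: nat \<Rightarrow> 'p padic poly"
  obtain c where c: "?S i * ?S j = (\<Sum>k\<le>(i + j) div 2. smult (c k) (even_basis k))"
    using s_index_poly_mult_integral_even[OF assms(1,3,4)] unfolding integral_even_def by blast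
  from has_linear_coeff_even_basis_sum[of c "(i + j) div 2", folded c]
  obtain g where g: "\<And>N. (\<Sum>n<N. s_poly n (of_nat i) * s_poly n (of_nat j :: 'p padic)) = of_nat N * poly g (of_nat N ^ 2)"
    unfolding has_linear_coeff_def by (auto simp: poly_s_index_poly)
  define L where "L = (of_nat i * (of_nat i + 1) - of_nat j * (of_nat j + 1) :: 'p padic)"
  define W where "W = ?S i * pcompose (?S j) [:-1, 1:] - pcompose (?S i) [:-1, 1:] * ?S j"
  \<comment> \<open>The two sides after cancelling one \<open>N\<close>; at 0 only
    \<open>L * poly g 0\<close> remains.\<close>
  define h where "h = smult L (pcompose g [:0, 0, 1:]) - [:0, 1:] * W"
  have "h = 0"
  proof (rule poly_eq_0_if_zero_at_nats)
    fix N :: nat assume "N > 0"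
    then obtain m where m: "N = Suc m" using gr0_implies_Suc by blast
    have W: "poly W (of_nat N) = s_poly (Suc m) (of_nat i) * s_poly m (of_nat j) - s_poly m (of_nat i) * s_poly (Suc m) (of_nat j)"
    proof -
      have "poly [:-1, 1:] (of_nat N :: 'p padic) = of_nat m" by (simp add: m)
      then show ?thesis
        by (simp only: W_def poly_diff poly_mult poly_pcompose poly_s_index_poly) (simp add: m poly_s_index_poly)
    qed
    have "L * (of_nat N * poly g (of_nat N ^ 2)) = of_nat N ^ 2 * poly W (of_nat N)"
      using s_poly_Christoffel_Darboux[of "of_nat i :: 'p padic" "of_nat j" m] g[of N]
      unfolding W L_def by (simp add: m lessThan_Suc_atMost)
    then have "of_nat N * (L * poly g (of_nat N ^ 2)) = of_nat N * (of_nat N * poly W (of_nat N))"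
      by (simp only: power2_eq_square mult_ac)
    then show "poly h (of_nat N) = 0"
      using \<open>N > 0\<close> by (simp add: h_def poly_pcompose power2_eq_square)
  qed
  then have "poly h 0 = 0" by simp
  then have "L * poly g 0 = 0" by (simp add: h_def poly_pcompose)
  moreover have "L \<noteq> 0"
  proof -
    have "i * (i + 1) \<noteq> j * (j + 1)"
      using assms(2) by (metis add_less_mono1 mult_strict_mono' nat_neq_iff not_less_iff_gr_or_eq zero_le)
    then have "(of_nat (i * (i + 1)) :: 'p padic) \<noteq> of_nat (j * (j + 1))"
      unfolding of_nat_eq_iff .
    then show ?thesis by (simp add: L_def algebra_simps)
  qed
  ultimately show ?thesis
    unfolding has_linear_coeff_def using g by auto
qed

text \<open>The recurrences at \<open>x\<close> and at \<open>x + 1\<close> are combined so that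
  \<open>2 * n + 1\<close> drops out. The coefficients no longer depend on \<open>n\<close>, so the
  relation can be summed over \<open>n\<close>.\<close>

lemma s_poly_square_recurrence:
  fixes x :: "'a :: field_char_0"
  shows "(2 * x + 3) * (x + 1)\<^sup>2 * (s_poly n (x + 1))\<^sup>2
    = - ((2 * x + 1) * (x + 1)\<^sup>2 * (s_poly n x)\<^sup>2)
      + (2 * x + 3) * x\<^sup>2 * (s_poly n (x - 1) * s_poly n (x + 1))
      + (2 * x + 1) * (x + 2)\<^sup>2 * (s_poly n x * s_poly n (x + 2))"
proof -
  define d where "d = (2 * of_nat n + 1 :: 'a)"
  have 1: "(x + 1)\<^sup>2 * s_poly n (x + 1) = (2 * x + 1) * d * s_poly n x + x\<^sup>2 * s_poly n (x - 1)"
    using s_poly_recurrence_argument[of x n] by (simp add: d_def algebra_simps)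
  have 2: "(x + 2)\<^sup>2 * s_poly n (x + 2) = (2 * x + 3) * d * s_poly n (x + 1) + (x + 1)\<^sup>2 * s_poly n x"
    using s_poly_recurrence_argument[of "x + 1" n] by (simp add: d_def algebra_simps)
  have "(2 * x + 3) * (x + 1)\<^sup>2 * (s_poly n (x + 1))\<^sup>2 = (2 * x + 3) * s_poly n (x + 1) * ((x + 1)\<^sup>2 * s_poly n (x + 1))"
    by (simp add: power2_eq_square mult_ac)
  also have "\<dots> = (2 * x + 1) * s_poly n x * ((2 * x + 3) * d * s_poly n (x + 1))
      + (2 * x + 3) * x\<^sup>2 * (s_poly n (x - 1) * s_poly n (x + 1))"
    unfolding 1 by (simp add: algebra_simps)
  also have "(2 * x + 3) * d * s_poly n (x + 1) = (x + 2)\<^sup>2 * s_poly n (x + 2) - (x + 1)\<^sup>2 * s_poly n x"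
    using 2 by simp
  finally show ?thesis
    by (simp add: algebra_simps power2_eq_square)
qed

text \<open>In \<open>s_poly_square_recurrence\<close> the mixed products contribute 0 by
  orthogonality, so each step multiplies the coefficient by
  \<open>-(2 * j + 1) / (2 * j + 3)\<close>.\<close>

lemma has_linear_coeff_s_poly_square:
  assumes "2 * j + 1 \<le> CARD('p)" "3 < CARD('p)"
  shows "has_linear_coeff (\<lambda>n. (s_poly n (of_nat j :: 'p :: prime_card padic))\<^sup>2) ((- 1) ^ j / of_nat (2 * j + 1))"
  using assms(1)
proof (induction j)
  case 0
  show ?case
    unfolding has_linear_coeff_def by (intro exI[of _ 1]) simp
next
  case (Suc j)
  let ?j = "of_nat j :: 'p padic"
  have 1: "has_linear_coeff (\<lambda>n. (s_poly n ?j)\<^sup>2) ((- 1) ^ j / of_nat (2 * j + 1))"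
    using Suc by simp
  have 2: "has_linear_coeff (\<lambda>n. (2 * ?j + 3) * ?j\<^sup>2 * (s_poly n (?j - 1) * s_poly n (?j + 1))) 0"
  \<comment> \<open>For \<open>j = 0\<close> the argument \<open>-1\<close> disappears with the
    factor \<open>j^2\<close>.\<close>
  proof (cases j)
    case 0
    then show ?thesis unfolding has_linear_coeff_def by (intro exI[of _ 0]) simp
  next
    case (Suc i)
    then have "has_linear_coeff (\<lambda>n. s_poly n (of_nat i) * s_poly n (of_nat (Suc j) :: 'p padic)) 0"
      using Suc.prems by (intro has_linear_coeff_s_poly_orthogonal) auto
    from has_linear_coeff_cmult[OF this, of "(2 * ?j + 3) * ?j\<^sup>2"]
    show ?thesis by (simp add: Suc algebra_simps)
  qed
  have "has_linear_coeff (\<lambda>n. s_poly n ?j * s_poly n (of_nat (j + 2) :: 'p padic)) 0"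
    using Suc.prems assms(2) by (intro has_linear_coeff_s_poly_orthogonal) auto
  then have 3: "has_linear_coeff (\<lambda>n. s_poly n ?j * s_poly n (?j + 2)) 0"
    by (simp add: add.commute)
  define a where "a = (2 * ?j + 3) * (?j + 1)\<^sup>2"
  have nz: "(of_nat (2 * j + 1) :: 'p padic) \<noteq> 0" "(of_nat (2 * j + 3) :: 'p padic) \<noteq> 0"
    unfolding of_nat_eq_0_iff by simp_all
  have j1: "?j + 1 \<noteq> 0" by (metis of_nat_Suc of_nat_neq_0 add.commute)
  then have a: "a \<noteq> 0" using nz(2) by (simp add: a_def)
  have "has_linear_coeff (\<lambda>n. 1 / a * (- ((2 * ?j + 1) * (?j + 1)\<^sup>2) * (s_poly n ?j)\<^sup>2
      + (2 * ?j + 3) * ?j\<^sup>2 * (s_poly n (?j - 1) * s_poly n (?j + 1))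
      + (2 * ?j + 1) * (?j + 2)\<^sup>2 * (s_poly n ?j * s_poly n (?j + 2))))
     (1 / a * (- ((2 * ?j + 1) * (?j + 1)\<^sup>2) * ((- 1) ^ j / of_nat (2 * j + 1)) + 0 + (2 * ?j + 1) * (?j + 2)\<^sup>2 * 0))"
    by (intro has_linear_coeff_cmult[of _ _ "1 / a"] has_linear_coeff_add 2 has_linear_coeff_cmult[OF 1] has_linear_coeff_cmult[OF 3])
  moreover have "1 / a * (- ((2 * ?j + 1) * (?j + 1)\<^sup>2) * (s_poly n ?j)\<^sup>2
      + (2 * ?j + 3) * ?j\<^sup>2 * (s_poly n (?j - 1) * s_poly n (?j + 1))
      + (2 * ?j + 1) * (?j + 2)\<^sup>2 * (s_poly n ?j * s_poly n (?j + 2))) = (s_poly n (of_nat (Suc j) :: 'p padic))\<^sup>2" for n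
  proof -
    have "a * (s_poly n (?j + 1))\<^sup>2 = - ((2 * ?j + 1) * (?j + 1)\<^sup>2) * (s_poly n ?j)\<^sup>2
      + (2 * ?j + 3) * ?j\<^sup>2 * (s_poly n (?j - 1) * s_poly n (?j + 1))
      + (2 * ?j + 1) * (?j + 2)\<^sup>2 * (s_poly n ?j * s_poly n (?j + 2))"
      using s_poly_square_recurrence[of ?j n] by (simp add: a_def)
    from this [symmetric] show ?thesis using a by (simp add: add.commute)
  qed
  moreover have "1 / a * (- ((2 * ?j + 1) * (?j + 1)\<^sup>2) * ((- 1) ^ j / of_nat (2 * j + 1)) + 0 + (2 * ?j + 1) * (?j + 2)\<^sup>2 * 0)
     = (- 1) ^ Suc j / of_nat (2 * Suc j + 1)"
  proof -
    have "a = of_nat (2 * j + 3) * (?j + 1)\<^sup>2" "2 * ?j + 1 = of_nat (2 * j + 1)" "of_nat (2 * Suc j + 1) = (of_nat (2 * j + 3) :: 'p padic)"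
      by (simp_all add: a_def)
    then show ?thesis using nz j1 by (simp only:) (simp add: divide_simps)
  qed
  ultimately show ?case by simp
qed

section \<open>Sums of even polynomials over n < p, modulo p^3\<close>

lemma inverse_square_cong:
  fixes a :: "'p :: prime_card padic"
  assumes "1 / a \<in> \<int>\<^sub>p" "1 / b \<in> \<int>\<^sub>p" "a \<in> \<int>\<^sub>p" "b \<in> \<int>\<^sub>p" "a \<noteq> 0" "b \<noteq> 0" "a + b \<in> padic_ideal 1"
  shows "1 / a\<^sup>2 - 1 / b\<^sup>2 \<in> padic_ideal 1"
proof -
  have "1 / a\<^sup>2 - 1 / b\<^sup>2 = (a + b) * ((b - a) * (1 / a * (1 / a) * (1 / b * (1 / b))))"
    using assms(5,6) by (simp add: divide_simps power2_eq_square) (simp add: algebra_simps)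
  also have "\<dots> \<in> padic_ideal 1"
    by (intro padic_ideal_mult_right padic_Ints_intros assms)
  finally show ?thesis .
qed

text \<open>Splitting \<open>\<Sum>0<i<p. 1 / i\<^sup>2\<close> once by the size and once by the parity of \<open>i\<close> shows that
  the half sum \<open>T\<close> satisfies \<open>2 * T \<equiv> T / 2\<close>.\<close>

lemma half_sum_inverse_squares_mod:
  assumes "CARD('p) = 2 * h + 1" "3 < CARD('p)"
  shows "(\<Sum>i<h. 1 / (of_nat i + 1)\<^sup>2) \<in> (padic_ideal 1 :: 'p :: prime_card padic set)"
proof -
  let ?p = "CARD('p)"
  define f where "f i = 1 / (of_nat i :: 'p padic)\<^sup>2" for i
  define T where "T = (\<Sum>i\<in>{1..h}. f i)"
  have refl: "f (?p - i) - f i \<in> padic_ideal 1" if "0 < i" "i < ?p" for i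
    unfolding f_def
  proof (rule inverse_square_cong)
    have "of_nat (?p - i) + (of_nat i :: 'p padic) = of_nat ?p"
      using that by (simp flip: of_nat_add)
    then show "of_nat (?p - i) + (of_nat i :: 'p padic) \<in> padic_ideal 1" by simp
  qed (use that in \<open>auto simp del: of_nat_diff intro: inverse_of_nat_less_in_padic_Ints\<close>)
  have refl_sum: "(\<Sum>i\<in>{1..h}. f (?p - g i)) - (\<Sum>i\<in>{1..h}. f (g i)) \<in> padic_ideal 1"
    if "\<And>i. i \<in> {1..h} \<Longrightarrow> 0 < g i \<and> g i < ?p" for g
    unfolding sum_subtractf [symmetric] using that by (intro padic_ideal_sum refl) auto
  have "(\<Sum>i\<in>{1..<?p}. f i) = T + (\<Sum>i\<in>{h<..<?p}. f i)"
  proof -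
    have "{1..<?p} = {1..h} \<union> {h<..<?p}" using assms by auto
    then show ?thesis unfolding T_def by (simp only:) (rule sum.union_disjoint; auto)
  qed
  also have "(\<Sum>i\<in>{h<..<?p}. f i) = (\<Sum>i\<in>{1..h}. f (?p - i))"
    by (rule sum.reindex_bij_witness[of _ "\<lambda>i. ?p - i" "\<lambda>i. ?p - i"]) (use assms in auto)
  finally have 1: "(\<Sum>i\<in>{1..<?p}. f i) - 2 * T \<in> padic_ideal 1"
    using refl_sum[of "\<lambda>i. i"] assms by (simp add: T_def algebra_simps)
  have "(\<Sum>i\<in>{1..<?p}. f i) = (\<Sum>i\<in>{i\<in>{1..<?p}. even i}. f i) + (\<Sum>i\<in>{i\<in>{1..<?p}. odd i}. f i)"
  proof -
    have "{1..<?p} = {i\<in>{1..<?p}. even i} \<union> {i\<in>{1..<?p}. odd i}" by auto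
    then show ?thesis by (metis (no_types, lifting) sum.union_disjoint finite_Un finite_atLeastLessThan
          Collect_disj_eq disjoint_iff mem_Collect_eq)
  qed
  also have "(\<Sum>i\<in>{i\<in>{1..<?p}. even i}. f i) = (\<Sum>i\<in>{1..h}. f (2 * i))"
    by (rule sum.reindex_bij_witness[of _ "\<lambda>i. 2 * i" "\<lambda>i. i div 2"]) (use assms in auto)
  also have "(\<Sum>i\<in>{i\<in>{1..<?p}. odd i}. f i) = (\<Sum>i\<in>{1..h}. f (?p - 2 * i))"
    by (rule sum.reindex_bij_witness[of _ "\<lambda>i. ?p - 2 * i" "\<lambda>i. (?p - i) div 2"])
       (use assms in \<open>auto elim!: oddE\<close>)
  finally have "(\<Sum>i\<in>{1..<?p}. f i) - 2 * (\<Sum>i\<in>{1..h}. f (2 * i)) \<in> padic_ideal 1"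
    using refl_sum[of "\<lambda>i. 2 * i"] assms by (simp add: algebra_simps)
  moreover have "2 * (\<Sum>i\<in>{1..h}. f (2 * i)) = T / 2"
    by (simp add: T_def f_def sum_distrib_left sum_divide_distrib power_mult_distrib mult.commute)
  ultimately have 2: "(\<Sum>i\<in>{1..<?p}. f i) - T / 2 \<in> padic_ideal 1" by (simp only:)
  \<comment> \<open>The two evaluations differ by \<open>3 * T / 2\<close>, and 3 can be cancelled
    as \<open>p > 3\<close>.\<close>
  have "2 * (((\<Sum>i\<in>{1..<?p}. f i) - T / 2) - ((\<Sum>i\<in>{1..<?p}. f i) - 2 * T)) \<in> padic_ideal 1"
    by (intro padic_ideal_mult_left padic_ideal_diff 1 2) simp
  then have "of_nat 3 * T \<in> padic_ideal 1" by (simp add: algebra_simps)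
  then have "T \<in> padic_ideal 1"
    by (rule padic_ideal_of_nat_mult_cancel) (use assms in auto)
  moreover have "T = (\<Sum>i<h. 1 / (of_nat i + 1)\<^sup>2)"
    unfolding T_def f_def
    by (rule sum.reindex_bij_witness[of _ Suc "\<lambda>i. i - 1"]) (auto simp: add.commute)
  ultimately show ?thesis by simp
qed

text \<open>The product expanded to first order in \<open>q^2\<close>; the neglected terms carry
  \<open>q^4\<close> with integral coefficients because \<open>k < p\<close>.\<close>

lemma prod_CARD_square_minus_squares_mod:
  fixes q :: "'p :: prime_card padic"
  assumes "k < CARD('p)"
  defines "q \<equiv> of_nat CARD('p)"
  shows "(\<Prod>i<k. q\<^sup>2 - (of_nat i + 1)\<^sup>2)
      - (\<Prod>i<k. - ((of_nat i + 1)\<^sup>2)) * (1 - q\<^sup>2 * (\<Sum>i<k. 1 / (of_nat i + 1)\<^sup>2)) \<in> padic_ideal 4"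
  using assms(1)
proof (induction k)
  case (Suc k)
  define a where "a = (of_nat k + 1 :: 'p padic)\<^sup>2"
  define A where "A = (\<Prod>i<k. q\<^sup>2 - (of_nat i + 1)\<^sup>2)"
  define Z where "Z = (\<Prod>i<k. - ((of_nat i + 1 :: 'p padic)\<^sup>2))"
  define H where "H = (\<Sum>i<k. 1 / (of_nat i + 1 :: 'p padic)\<^sup>2)"
  have "a = of_nat (Suc k) ^ 2" by (simp add: a_def add.commute)
  then have a: "a \<noteq> 0" "a \<in> \<int>\<^sub>p"
    by (simp_all del: of_nat_Suc add: padic_Ints_power)
  have ZI: "Z \<in> \<int>\<^sub>p" unfolding Z_def by (intro padic_Ints_intros) simp_all
  have HI: "H \<in> \<int>\<^sub>p" unfolding H_def
  proof (rule padic_Ints_sum)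
    fix i assume "i \<in> {..<k}"
    then have "1 / of_nat (Suc i) / of_nat (Suc i) \<in> (\<int>\<^sub>p :: 'p padic set)"
      using Suc.prems by (intro padic_Ints_divide_of_nat) auto
    then show "1 / (of_nat i + 1)\<^sup>2 \<in> (\<int>\<^sub>p :: 'p padic set)"
      by (simp add: power2_eq_square add.commute)
  qed
  have q: "q \<in> \<int>\<^sub>p" "q ^ 4 \<in> padic_ideal 4" by (simp_all add: q_def)
  have IH: "A - Z * (1 - q\<^sup>2 * H) \<in> padic_ideal 4"
    using Suc by (simp add: A_def Z_def H_def)
  have "A * (q\<^sup>2 - a) - Z * (- a) * (1 - q\<^sup>2 * (H + 1 / a)) = (A - Z * (1 - q\<^sup>2 * H)) * (q\<^sup>2 - a) - q ^ 4 * (Z * H)"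
    using a(1) by (simp add: algebra_simps eval_nat_numeral)
  also have "\<dots> \<in> padic_ideal 4"
    by (intro padic_ideal_diff[OF padic_ideal_mult_right[OF IH] padic_ideal_mult_right[OF q(2)]] padic_Ints_intros q a ZI HI)
  finally show ?case by (simp add: A_def Z_def H_def a_def)
qed simp

text \<open>If \<open>2 * k + 1 < p\<close>, the denominator is a unit, and \<open>q\<close> times a
  change divisible by \<open>q^2\<close> suffices. If \<open>2 * k + 1 = p\<close>, the denominator
  consumes \<open>q\<close>, and the half sum of inverse squares supplies the missing power.\<close>

lemma even_basis_sum_mod:
  fixes q :: "'p :: prime_card padic"
  assumes "2 * k + 1 \<le> CARD('p)" "3 < CARD('p)"
  defines "q \<equiv> of_nat CARD('p)"
  shows "q * (poly (even_basis_sum k) (q\<^sup>2) - poly (even_basis_sum k) 0) \<in> padic_ideal 3"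
proof -
  define D where "D = (\<Prod>i<k. q\<^sup>2 - (of_nat i + 1)\<^sup>2) - (\<Prod>i<k. 0 - (of_nat i + 1 :: 'p padic)\<^sup>2)"
  have eq: "q * (poly (even_basis_sum k) (q\<^sup>2) - poly (even_basis_sum k) 0) = q * D / of_nat (2 * k + 1)"
    by (simp only: poly_even_basis_sum D_def diff_divide_distrib right_diff_distrib times_divide_eq_right)
  show ?thesis
  proof (cases "2 * k + 1 = CARD('p)")
    case False
    have "D \<in> padic_ideal 2"
      unfolding D_def q_def by (intro padic_ideal_prod_diff padic_Ints_intros) simp_all
    then have "q * D \<in> padic_ideal (1 + 2)"
      unfolding q_def by (intro padic_ideal_mult) simp_all
    then have "q * D / of_nat (2 * k + 1) \<in> padic_ideal (1 + 2)"
      using False assms(1) by (intro padic_ideal_divide_of_nat) auto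
    then show ?thesis unfolding eq by (simp add: numeral_3_eq_3)
  next
    case True
    define Z where "Z = (\<Prod>i<k. - ((of_nat i + 1 :: 'p padic)\<^sup>2))"
    define H where "H = (\<Sum>i<k. 1 / (of_nat i + 1 :: 'p padic)\<^sup>2)"
    have ZI: "Z \<in> \<int>\<^sub>p" unfolding Z_def by (intro padic_Ints_intros) simp_all
    have HI: "H \<in> padic_ideal 1" unfolding H_def
      using True assms(2) by (intro half_sum_inverse_squares_mod) auto
    have "q\<^sup>2 * H \<in> padic_ideal (2 + 1)"
      unfolding q_def by (intro padic_ideal_mult HI CARD_power_in_padic_ideal)
    then have 1: "Z * (q\<^sup>2 * H) \<in> padic_ideal 3"
      using padic_ideal_mult_left[OF ZI] by simp
    have "D + Z * (q\<^sup>2 * H) \<in> padic_ideal 4"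
      using prod_CARD_square_minus_squares_mod[of k, where 'p='p] True
      by (simp add: D_def Z_def H_def q_def algebra_simps)
    then have "D + Z * (q\<^sup>2 * H) \<in> padic_ideal 3"
      using padic_ideal_antimono[of 3 4, where 'a='p] by auto
    from padic_ideal_diff[OF this 1] have "D \<in> padic_ideal 3" by simp
    moreover have "q * D / of_nat (2 * k + 1) = D"
      unfolding True q_def by simp
    ultimately show ?thesis unfolding eq by simp
  qed
qed

text \<open>Uniqueness identifies \<open>c\<close> with the linear coefficient of the basis
  expansion, and \<open>even_basis_sum_mod\<close> bounds the higher terms for each basis
  element.\<close>

lemma sum_integral_even_mod:
  fixes F :: "'p :: prime_card padic poly"
  assumes "F \<in> integral_even d" "2 * d + 1 \<le> CARD('p)" "3 < CARD('p)"
    and "has_linear_coeff (\<lambda>n. poly F (of_nat n)) c"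
  shows "(\<Sum>n<CARD('p). poly F (of_nat n)) - of_nat CARD('p) * c \<in> padic_ideal 3"
proof -
  define q where "q = (of_nat CARD('p) :: 'p padic)"
  obtain a where a: "\<forall>k. a k \<in> \<int>\<^sub>p" "F = (\<Sum>k\<le>d. smult (a k) (even_basis k))"
    using assms(1) by (auto simp: integral_even_def)
  have c: "c = (\<Sum>k\<le>d. a k * poly (even_basis_sum k) 0)"
    using has_linear_coeff_unique[OF assms(4)] has_linear_coeff_even_basis_sum[of a d] a(2) by blast
  have "(\<Sum>n<CARD('p). poly F (of_nat n)) = (\<Sum>k\<le>d. a k * (\<Sum>n<CARD('p). poly (even_basis k) (of_nat n)))"
    unfolding a(2) poly_sum poly_smult sum_distrib_left by (rule sum.swap)
  then have "(\<Sum>n<CARD('p). poly F (of_nat n)) - q * c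
     = (\<Sum>k\<le>d. a k * (q * (poly (even_basis_sum k) (q\<^sup>2) - poly (even_basis_sum k) 0)))"
    unfolding sum_even_basis c q_def [symmetric] sum_distrib_left
    by (simp add: algebra_simps flip: sum_subtractf)
  also have "\<dots> \<in> padic_ideal 3"
    unfolding q_def using a(1) assms(2,3)
    by (intro padic_ideal_sum padic_ideal_mult_left even_basis_sum_mod) auto
  finally show ?thesis by (simp add: q_def)
qed

section \<open>Natural arguments: orthogonality and sums of squares modulo p^3\<close>

lemma s_poly_Christoffel_Darboux_of_nat:
  assumes "i < j"
  shows "of_nat ((j - i) * (i + j + 1)) * (\<Sum>n<CARD('p). s_poly n (of_nat i) * s_poly n (of_nat j))
     = (of_nat CARD('p) :: 'p :: prime_card padic)\<^sup>2 * (s_poly (CARD('p) - 1) (of_nat i) * s_poly CARD('p) (of_nat j)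
         - s_poly CARD('p) (of_nat i) * s_poly (CARD('p) - 1) (of_nat j))"
proof -
  obtain m where m: "CARD('p) = Suc m"
    using prime_gt_0_nat[OF prime_card[where 'a='p]] gr0_implies_Suc by blast
  have L: "(of_nat ((j - i) * (i + j + 1)) :: 'p padic) = - (of_nat i * (of_nat i + 1) - of_nat j * (of_nat j + 1))"
    using assms
    by (simp only: of_nat_mult of_nat_diff[OF less_imp_le] of_nat_add of_nat_1) (simp add: algebra_simps)
  show ?thesis
    unfolding L mult_minus_left m lessThan_Suc_atMost s_poly_Christoffel_Darboux by (simp add: algebra_simps)
qed

lemma padic_ideal_of_nat_mult_cancel_coprime:
  assumes "of_nat n * a \<in> padic_ideal m" "\<not> CARD('p) dvd n"
  shows "(a :: 'p :: prime_card padic) \<in> padic_ideal m"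
  using padic_ideal_mult_left[OF inverse_of_nat_in_padic_Ints[OF assms(2)] assms(1)] assms(2)
  by (cases "n = 0") auto

lemma not_CARD_dvd_if_less:
  assumes "0 < a" "a < CARD('p)" "CARD('p) < b" "b < 2 * CARD('p)"
  shows "\<not> CARD('p :: prime_card) dvd a * b"
proof -
  have "\<not> CARD('p) dvd a" using assms by (simp add: nat_dvd_not_less)
  moreover have "\<not> CARD('p) dvd b"
  proof
    assume "CARD('p) dvd b"
    then have "CARD('p) dvd b - CARD('p)" using assms by (intro dvd_diff_nat) auto
    then show False using assms by (auto dest: dvd_imp_le)
  qed
  ultimately show ?thesis
    using prime_card[where 'a='p] by (simp add: prime_dvd_mult_iff)
qed

text \<open>For \<open>i + j < p\<close> the linear coefficient is 0. Otherwise Christoffel-Darboux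
  gives \<open>p^2\<close>, and its bracket one more \<open>p\<close>, since by equal parity both
  products are \<open>(- 1) ^ i\<close> modulo \<open>p\<close>; \<open>i + j + 1\<close> lies
  strictly between \<open>p\<close> and \<open>2 * p\<close>.\<close>

lemma s_poly_orthogonal_mod:
  assumes "even (i + j)" "i < j" "j < CARD('p)" "3 < CARD('p)"
  shows "(\<Sum>n<CARD('p). s_poly n (of_nat i) * s_poly n (of_nat j)) \<in> (padic_ideal 3 :: 'p :: prime_card padic set)"
proof (cases "i + j < CARD('p)")
  case True
  have "has_linear_coeff (\<lambda>n. poly (s_index_poly i * s_index_poly j :: 'p padic poly) (of_nat n)) 0"
    using has_linear_coeff_s_poly_orthogonal[of i j, where 'p='p] assms by (simp add: poly_s_index_poly)
  moreover have "s_index_poly i * s_index_poly j \<in> (integral_even ((i + j) div 2) :: 'p padic poly set)"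
    using assms by (intro s_index_poly_mult_integral_even) auto
  moreover have "2 * ((i + j) div 2) + 1 \<le> CARD('p)" using True by linarith
  ultimately have "(\<Sum>n<CARD('p). poly (s_index_poly i * s_index_poly j) (of_nat n)) - of_nat CARD('p) * 0
      \<in> (padic_ideal 3 :: 'p padic set)"
    using assms(4) by (intro sum_integral_even_mod)
  then show ?thesis by (simp add: poly_s_index_poly)
next
  case False
  let ?a = "\<lambda>i. s_poly (CARD('p) - 1) (of_nat i :: 'p padic)" and ?b = "\<lambda>i. s_poly CARD('p) (of_nat i :: 'p padic)"
  have sgn: "(- 1 :: 'p padic) ^ j = (- 1) ^ i" using assms(1) by (metis even_add minus_one_power_iff)
  have m: "?a i - (- 1) ^ i \<in> padic_ideal 1" "?a j - (- 1) ^ i \<in> padic_ideal 1" "?b i - 1 \<in> padic_ideal 1" "?b j - 1 \<in> padic_ideal 1"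
    using s_poly_CARD_minus_1_mod[of i, where 'p='p] s_poly_CARD_minus_1_mod[of j, where 'p='p]
      s_poly_CARD_mod[of i, where 'p='p] s_poly_CARD_mod[of j, where 'p='p] assms sgn by simp_all
  have aI: "?a i \<in> \<int>\<^sub>p" "?a j \<in> \<int>\<^sub>p"
    using s_poly_in_padic_Ints[OF padic_Ints_of_nat, of "CARD('p) - 1" i, where 'p='p]
      s_poly_in_padic_Ints[OF padic_Ints_of_nat, of "CARD('p) - 1" j, where 'p='p] assms(4) by auto
  have "?a i * ?b j - ?b i * ?a j
     = ?a i * (?b j - 1) - (?b i - 1) * ?a j + ((?a i - (- 1) ^ i) - (?a j - (- 1) ^ i))"
    by (simp add: algebra_simps)
  also have "\<dots> \<in> padic_ideal 1"
  proof (rule padic_ideal_add)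
    show "?a i * (?b j - 1) - (?b i - 1) * ?a j \<in> padic_ideal 1"
      by (rule padic_ideal_diff) (rule padic_ideal_mult_left[OF aI(1) m(4)] padic_ideal_mult_right[OF m(3) aI(2)])+
    show "(?a i - (- 1) ^ i) - (?a j - (- 1) ^ i) \<in> padic_ideal 1"
      by (rule padic_ideal_diff[OF m(1,2)])
  qed
  finally have "of_nat ((j - i) * (i + j + 1)) * (\<Sum>n<CARD('p). s_poly n (of_nat i) * s_poly n (of_nat j))
      \<in> (padic_ideal (2 + 1) :: 'p padic set)"
    unfolding s_poly_Christoffel_Darboux_of_nat[OF assms(2)]
    by (intro padic_ideal_mult CARD_power_in_padic_ideal)
  moreover have "\<not> CARD('p) dvd (j - i) * (i + j + 1)"
    using False assms by (intro not_CARD_dvd_if_less) auto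
  ultimately have "(\<Sum>n<CARD('p). s_poly n (of_nat i) * s_poly n (of_nat j)) \<in> (padic_ideal (2 + 1) :: 'p padic set)"
    by (rule padic_ideal_of_nat_mult_cancel_coprime)
  then show ?thesis by simp
qed

text \<open>The recurrence step that reaches \<open>p - 1\<close> involves the argument
  \<open>p\<close>, but with coefficient \<open>p^2\<close>, so the modulus \<open>p^2\<close> is
  enough here.\<close>

lemma s_poly_orthogonal_CARD_mod:
  assumes "i + 2 = CARD('p)" "3 < CARD('p)"
  shows "(\<Sum>n<CARD('p). s_poly n (of_nat i) * s_poly n (of_nat (i + 2))) \<in> (padic_ideal 2 :: 'p :: prime_card padic set)"
proof -
  have I: "s_poly (CARD('p) - 1) (of_nat k :: 'p padic) \<in> \<int>\<^sub>p" for k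
    using s_poly_in_padic_Ints[OF padic_Ints_of_nat, of "CARD('p) - 1" k, where 'p='p] assms(2) by auto
  have less: "i < i + 2" by simp
  have "of_nat ((i + 2 - i) * (i + (i + 2) + 1)) * (\<Sum>n<CARD('p). s_poly n (of_nat i) * s_poly n (of_nat (i + 2)))
      \<in> (padic_ideal 2 :: 'p padic set)"
    unfolding s_poly_Christoffel_Darboux_of_nat[OF less]
    by (intro padic_ideal_mult_right padic_Ints_intros I s_poly_CARD_in_padic_Ints padic_Ints_of_nat CARD_power_in_padic_ideal)
  moreover have "\<not> CARD('p) dvd (i + 2 - i) * (i + (i + 2) + 1)"
    using assms by (intro not_CARD_dvd_if_less) auto
  ultimately show ?thesis by (rule padic_ideal_of_nat_mult_cancel_coprime)
qed

lemma sum_s_poly_square_of_nat_small: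
  assumes "2 * j + 1 \<le> CARD('p)" "3 < CARD('p)"
  shows "(\<Sum>n<CARD('p). (s_poly n (of_nat j))\<^sup>2) - of_nat CARD('p) * ((- 1) ^ j / of_nat (2 * j + 1))
    \<in> (padic_ideal 3 :: 'p :: prime_card padic set)"
proof -
  have "has_linear_coeff (\<lambda>n. poly (s_index_poly j * s_index_poly j :: 'p padic poly) (of_nat n)) ((- 1) ^ j / of_nat (2 * j + 1))"
    using has_linear_coeff_s_poly_square[OF assms] by (simp add: poly_s_index_poly power2_eq_square)
  moreover have "s_index_poly j * s_index_poly j \<in> (integral_even ((j + j) div 2) :: 'p padic poly set)"
    using assms by (intro s_index_poly_mult_integral_even) auto
  moreover have "2 * ((j + j) div 2) + 1 \<le> CARD('p)" using assms by linarith
  ultimately have "(\<Sum>n<CARD('p). poly (s_index_poly j * s_index_poly j) (of_nat n))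
      - of_nat CARD('p) * ((- 1) ^ j / of_nat (2 * j + 1)) \<in> (padic_ideal 3 :: 'p padic set)"
    using assms(2) by (intro sum_integral_even_mod)
  then show ?thesis by (simp add: poly_s_index_poly power2_eq_square)
qed

lemma mult_diff_divide_cancel:
  "a \<noteq> 0 \<Longrightarrow> a * (s - b * (c / a)) = a * s - b * (c :: 'a :: field)"
  by (simp add: right_diff_distrib)

text \<open>Induction upwards from \<open>h = (p - 1) / 2\<close> by the summed square recurrence.
  The factor \<open>2 * j + 1\<close> is kept on the left because it equals \<open>p\<close> at the
  start; each step divides only by \<open>(j + 1)^2\<close>.\<close>

lemma sum_s_poly_square_of_nat_large:
  assumes "CARD('p) = 2 * h + 1" "3 < CARD('p)" "h \<le> j" "j < CARD('p)"
  shows "of_nat (2 * j + 1) * (\<Sum>n<CARD('p). (s_poly n (of_nat j))\<^sup>2) - of_nat CARD('p) * (- 1) ^ j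
    \<in> (padic_ideal 3 :: 'p :: prime_card padic set)"
  using assms(3,4)
proof (induction j rule: dec_induct)
  case base
  have "of_nat (2 * h + 1) * ((\<Sum>n<CARD('p). (s_poly n (of_nat h))\<^sup>2) - of_nat CARD('p) * ((- 1) ^ h / of_nat (2 * h + 1)))
    \<in> (padic_ideal 3 :: 'p padic set)"
    using assms by (intro padic_ideal_mult_left padic_Ints_of_nat sum_s_poly_square_of_nat_small) simp_all
  moreover have nz: "(of_nat (2 * h + 1) :: 'p padic) \<noteq> 0" unfolding of_nat_eq_0_iff by simp
  ultimately show ?case
    unfolding mult_diff_divide_cancel[OF nz] by simp
next
  case (step j)
  let ?j = "of_nat j :: 'p padic"
  define N where "N x y = (\<Sum>n<CARD('p). s_poly n x * s_poly n (y :: 'p padic))" for x y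
  define q where "q = (of_nat CARD('p) :: 'p padic)"
  have IH: "(2 * ?j + 1) * N ?j ?j - q * (- 1) ^ j \<in> padic_ideal 3"
    using step by (simp add: N_def q_def power2_eq_square add.commute)
  have "h \<ge> 2" using assms by simp
  then have "N (of_nat (j - 1)) (of_nat (j + 1)) \<in> padic_ideal 3"
    unfolding N_def using step assms by (intro s_poly_orthogonal_mod) auto
  then have prev: "N (?j - 1) (?j + 1) \<in> padic_ideal 3"
    using \<open>h \<ge> 2\<close> step.hyps by (simp add: of_nat_diff add.commute)
  have "(?j + 2)\<^sup>2 * N ?j (of_nat (j + 2)) \<in> padic_ideal 3"
  proof (cases "j + 2 = CARD('p)")
    case True
    have "of_nat CARD('p) ^ 2 * N ?j (of_nat (j + 2)) \<in> padic_ideal (2 + 2)"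
      unfolding N_def by (intro padic_ideal_mult CARD_power_in_padic_ideal s_poly_orthogonal_CARD_mod True assms)
    moreover have "?j + 2 = of_nat CARD('p)" unfolding True [symmetric] by simp
    ultimately show ?thesis
      using padic_ideal_antimono[of 3 4, where 'a='p] by auto
  next
    case False
    then have "N ?j (of_nat (j + 2)) \<in> padic_ideal 3"
      unfolding N_def using step assms by (intro s_poly_orthogonal_mod) auto
    then show ?thesis by (intro padic_ideal_mult_left padic_Ints_intros) simp_all
  qed
  then have nxt: "(?j + 2)\<^sup>2 * N ?j (?j + 2) \<in> padic_ideal 3"
    by (simp add: add.commute)
  have rec: "(2 * ?j + 3) * (?j + 1)\<^sup>2 * N (?j + 1) (?j + 1)
     = - ((2 * ?j + 1) * (?j + 1)\<^sup>2 * N ?j ?j) + (2 * ?j + 3) * ?j\<^sup>2 * N (?j - 1) (?j + 1)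
       + (2 * ?j + 1) * (?j + 2)\<^sup>2 * N ?j (?j + 2)"
    unfolding N_def power2_eq_square[of "s_poly _ _", symmetric] sum_distrib_left s_poly_square_recurrence
    by (simp only: sum.distrib sum_negf)
  have "of_nat (Suc j) * (of_nat (Suc j) * (of_nat (2 * Suc j + 1) * N (?j + 1) (?j + 1) - q * (- 1) ^ Suc j))
     = (2 * ?j + 3) * (?j + 1)\<^sup>2 * N (?j + 1) (?j + 1) + (?j + 1)\<^sup>2 * (q * (- 1) ^ j)"
    by (simp add: algebra_simps power2_eq_square)
  also have "\<dots> = (2 * ?j + 3) * ?j\<^sup>2 * N (?j - 1) (?j + 1) + (2 * ?j + 1) * ((?j + 2)\<^sup>2 * N ?j (?j + 2))
       - (?j + 1)\<^sup>2 * ((2 * ?j + 1) * N ?j ?j - q * (- 1) ^ j)"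
    unfolding rec by (simp add: algebra_simps)
  also have "\<dots> \<in> padic_ideal 3"
  proof (rule padic_ideal_diff, rule padic_ideal_add)
    show "(2 * ?j + 3) * ?j\<^sup>2 * N (?j - 1) (?j + 1) \<in> padic_ideal 3"
      by (intro padic_ideal_mult_left[OF _ prev] padic_Ints_intros) simp_all
    show "(2 * ?j + 1) * ((?j + 2)\<^sup>2 * N ?j (?j + 2)) \<in> padic_ideal 3"
      by (intro padic_ideal_mult_left[OF _ nxt] padic_Ints_intros) simp_all
    show "(?j + 1)\<^sup>2 * ((2 * ?j + 1) * N ?j ?j - q * (- 1) ^ j) \<in> padic_ideal 3"
      by (intro padic_ideal_mult_left[OF _ IH] padic_Ints_intros) simp_all
  qed
  finally have "of_nat (2 * Suc j + 1) * N (?j + 1) (?j + 1) - q * (- 1) ^ Suc j \<in> padic_ideal 3"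
    using step.prems by (meson padic_ideal_of_nat_mult_cancel zero_less_Suc)
  then show ?case
    by (simp add: N_def q_def power2_eq_square add.commute)
qed

lemma sum_s_poly_square_of_nat_mod:
  assumes "j < CARD('p)" "3 < CARD('p)"
  shows "(\<Sum>n<CARD('p). (s_poly n (of_nat j))\<^sup>2) - (- 1) ^ j * of_nat CARD('p) / (2 * of_nat j + 1)
    \<in> (padic_ideal 3 :: 'p :: prime_card padic set)"
proof (cases "2 * j + 1 \<le> CARD('p)")
  case True
  then show ?thesis
    using sum_s_poly_square_of_nat_small[OF True assms(2)] by (simp add: mult.commute add.commute)
next
  case False
  have "odd (CARD('p))"
    using prime_card[where 'a='p] assms(2) prime_odd_nat by auto
  then obtain h where h: "CARD('p) = 2 * h + 1" by (rule oddE)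
  define S where "S = (\<Sum>n<CARD('p). (s_poly n (of_nat j :: 'p padic))\<^sup>2)"
  have nz: "(of_nat (2 * j + 1) :: 'p padic) \<noteq> 0" unfolding of_nat_eq_0_iff by simp
  have "of_nat (2 * j + 1) * S - of_nat CARD('p) * (- 1) ^ j \<in> padic_ideal 3"
    unfolding S_def using False h assms by (intro sum_s_poly_square_of_nat_large[OF h]) auto
  also have "of_nat (2 * j + 1) * S - of_nat CARD('p) * (- 1) ^ j
      = of_nat (2 * j + 1) * (S - (- 1) ^ j * of_nat CARD('p) / of_nat (2 * j + 1))"
    using mult_diff_divide_cancel[OF nz, of S "of_nat CARD('p)" "(- 1) ^ j"] by (simp add: mult.commute)
  finally have "S - (- 1) ^ j * of_nat CARD('p) / of_nat (2 * j + 1) \<in> padic_ideal 3"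
  proof (rule padic_ideal_of_nat_mult_cancel_coprime)
    \<comment> \<open>Here \<open>2 * j + 1\<close> lies strictly between \<open>p\<close> and
      \<open>2 * p\<close>.\<close>
    show "\<not> CARD('p) dvd 2 * j + 1"
      using not_CARD_dvd_if_less[of 1 "2 * j + 1", where 'p='p] False assms by simp
  qed
  then show ?thesis by (simp add: S_def add.commute)
qed

theorem theorem1p4:
  fixes p :: nat and x :: "'p :: prime_card padic"
  assumes "p = CARD('p)" and "p > 3" and "x \<in> \<int>\<^sub>p"
  shows "(\<not> [x \<equiv> - 1 / 2] (mod p) \<longrightarrow>
           [\<Sum>k=0..p - 1. (s_poly k x)\<^sup>2 \<equiv>
              (- 1) ^ \<langle>x\<rangle>\<^sub>p * ((of_nat p + 2 * (x - of_nat \<langle>x\<rangle>\<^sub>p)) / (2 * x + 1))] (mod p^2))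
       \<and> (\<forall>j \<in> {0..p - 1}.
           [\<Sum>k=0..p - 1. (s_poly k (of_nat j :: 'p padic))\<^sup>2 \<equiv>
              (- 1) ^ j * of_nat p / (2 * of_nat j + 1)] (mod p^3))
       \<and> [\<Sum>k=0..p - 1. of_nat (2 * k + 1) * (s_poly k x)\<^sup>2 \<equiv> 0] (mod p^2)"
proof (intro conjI impI ballI)
  have p3: "3 < CARD('p)" using assms by simp
  have range: "{..CARD('p) - 1} = {..<CARD('p)}"
    using p3 by auto
  have odd: "odd (CARD('p))"
    using prime_card[where 'a='p] p3 prime_odd_nat by auto
  show "[\<Sum>k=0..p - 1. of_nat (2 * k + 1) * (s_poly k x)\<^sup>2 \<equiv> 0] (mod p^2)"
    unfolding assms(1) padic_cong_iff atLeast0AtMost diff_zero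
    by (rule sum_odd_weighted_s_poly_square_mod[OF assms(3)])
  show "[\<Sum>k=0..p - 1. (s_poly k (of_nat j :: 'p padic))\<^sup>2 \<equiv>
              (- 1) ^ j * of_nat p / (2 * of_nat j + 1)] (mod p^3)" if "j \<in> {0..p - 1}" for j
    unfolding assms(1) padic_cong_iff atLeast0AtMost range
    using that assms by (intro sum_s_poly_square_of_nat_mod p3) auto
  assume n: "\<not> [x \<equiv> - 1 / 2] (mod p)"
  define r where "r = \<langle>x\<rangle>\<^sub>p"
  define S where "S = (\<Sum>k\<le>CARD('p) - 1. (s_poly k x)\<^sup>2)"
  obtain r' where r': "r' < CARD('p)" "x - of_nat r' \<in> padic_ideal 1"
    using padic_residue_exists[OF assms(3)] by blast
  have "[x \<equiv> of_nat r'] (mod CARD('p))"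
    using r' padic_cong_iff[of x "of_nat r'" 1] by simp
  \<comment> \<open>The witness \<open>r'\<close> bounds the least residue, which gives
    \<open>r < p\<close>.\<close>
  then have "[x \<equiv> of_nat r] (mod CARD('p))" "r \<le> r'"
    unfolding r_def least_residue_def by (rule LeastI, rule Least_le)
  then have r: "r < CARD('p)" "x - of_nat r \<in> padic_ideal 1"
    using r' padic_cong_iff[of x "of_nat r" 1] by simp_all
  have unit: "2 * x + 1 \<noteq> 0" "1 / (2 * x + 1) \<in> \<int>\<^sub>p"
  proof -
    \<comment> \<open>\<open>2 * x + 1\<close> is twice \<open>x - (- 1 / 2)\<close> and 2 is a
      unit, so the excluded congruence is exactly what would keep \<open>2 * x + 1\<close> from
      being a unit.\<close>
    have "2 * x + 1 \<notin> padic_ideal 1"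
    proof
      assume "2 * x + 1 \<in> padic_ideal 1"
      then have "of_nat 2 * (x - (- 1 / 2)) \<in> padic_ideal 1"
        by (simp add: algebra_simps)
      then have "x - (- 1 / 2) \<in> padic_ideal 1"
        by (rule padic_ideal_of_nat_mult_cancel) (use p3 in auto)
      then show False
        using n padic_cong_iff[of x "- 1 / 2" 1] assms(1) by simp
    qed
    moreover have "2 * x + 1 \<in> \<int>\<^sub>p"
      using assms(3) by (intro padic_Ints_intros) simp_all
    ultimately show "2 * x + 1 \<noteq> 0" "1 / (2 * x + 1) \<in> \<int>\<^sub>p"
      using padic_unit_or_divisible by blast+
  qed
  have "S - (- 1) ^ r * ((of_nat CARD('p) + 2 * (x - of_nat r)) / (2 * x + 1))
     = 1 / (2 * x + 1) * ((2 * x + 1) * S - (- 1) ^ r * (of_nat CARD('p) + 2 * (x - of_nat r)))"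
    using unit(1) by (simp add: right_diff_distrib)
  also have "\<dots> \<in> padic_ideal 2"
    unfolding S_def by (intro padic_ideal_mult_left unit(2) sum_s_poly_square_mod r odd assms(3))
  finally show "[\<Sum>k=0..p - 1. (s_poly k x)\<^sup>2 \<equiv>
        (- 1) ^ \<langle>x\<rangle>\<^sub>p * ((of_nat p + 2 * (x - of_nat \<langle>x\<rangle>\<^sub>p)) / (2 * x + 1))] (mod p^2)"
    unfolding assms(1) padic_cong_iff atLeast0AtMost r_def [symmetric] S_def [symmetric] .
qed

end
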